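(* Work in one of two settings: (M) the max-times algebra on $\mathbb{R}_+$, or (N) the usual nonnegative linear algebra on $\mathbb{R}_+$; all sums, products, Kleene stars, Perron roots and eigenvalues below are taken in the chosen setting. Let $A\in\mathbb{R}_+^{n\times n}$ be in Frobenius normal form with classes $N_j$, $j=1,\dots,s$, and let $\rho_j=\rho(A_{jj})$ be the Perron root of the diagonal block $A_{jj}=A_{N_jN_j}$. Let $b\in\mathbb{R}_+^n$ and $\lambda\ge 0$. Denote $J=\{j : N_j\longrightarrow \mathrm{supp}(b)\}$ and $\overline{\rho}=\max_{j\in J}\rho_j$ (for the case when $b=0$ and $J=\emptyset$ assume that $\max\emptyset=0$). The following are equivalent: (i) The system $\lambda x=Ax+b$ has a solution $x\in\mathbb{R}_+^n$. (ii) The system $\lambda x=Ax+b$ has the least solution in $\mathbb{R}_+^n$. (iii) $x^0=A_\lambda^{\ast}b_\lambda$ converges. (iv) If $j\in J$ then $(A_{jj})_\lambda^{\ast}$ converges. (v) $\overline{\rho}\le\lambda$ in setting (M); $\overline{\rho}<\lambda$ in setting (N). If any of these equivalent statements holds, then: (a) $x^0$ is the least solution of $\lambda x=Ax+b$. For this solution, $x^0_{N_i}\ne 0$ when $i\in J$ and $x^0_{N_i}=0$ when $i\notin J$. The solution $x^0$ is unique if and only if $\lambda$ is not an eigenvalue of $A$. (b) Any solution $x$ of $\lambda x=Ax+b$ can be expressed as $x=x^0+v$ where $v\in\mathbb{R}_+^n$ satisfies $Av=\lambda v$.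
   Context: $\mathbb{R}_+$ denotes the nonnegative reals. Setting (M), max-times algebra: $\mathbb{R}_+$ with the usual multiplication and with addition $a+b:=\max(a,b)$. Setting (N), usual nonnegative algebra: $\mathbb{R}_+$ with the usual addition and multiplication. In either setting $(A+B)_{ij}=a_{ij}+b_{ij}$, $(AB)_{ik}=\sum_j a_{ij}b_{jk}$, and $I$ is the usual identity matrix. Vectors are ordered componentwise. Notation: $A_\lambda:=A/\lambda$, $b_\lambda:=b/\lambda$, and $(A_{jj})_\lambda:=A_{jj}/\lambda$. The Kleene star of a square nonnegative matrix $B$ is $B^{\ast}=\sup_{k\ge0}(I+B+\dots+B^k)$; it converges if this supremum is finite in every entry. $B^{\ast}c:=\sup_{k\ge1}(c+Bc+\dots+B^{k-1}c)$; it converges if this supremum is finite in every component (which may happen even if $B^{\ast}$ does not converge). The digraph of $A=(a_{ij})$ has node set $\{1,\dots,n\}$ and arcs $(i,j)$ with $a_{ij}>0$. Node $i$ accesses node $j$, written $i\longrightarrow j$, if $i=j$ or there is a directed path from $i$ to $j$ in this digraph. For sets of nodes, $I\longrightarrow K$ if $i\longrightarrow k$ for some $i\in I$ and $k\in K$. $\mathrm{supp}(b)=\{i : b_i\neq0\}$. A square matrix is irreducible if it is $1\times1$ (possibly zero) or its digraph is strongly connected. $A$ is in Frobenius normal form (FNF) with classes $N_1,\dots,N_s$ if $\{1,\dots,n\}$ is partitioned into consecutive blocks $N_1,\dots,N_s$ such that, with $A_{ij}:=A_{N_iN_j}$ the submatrix with rows $N_i$ and columns $N_j$, $A$ is block lower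 triangular ($A_{ij}=0$ for $i<j$) and each diagonal block $A_{jj}$ is irreducible. $x_{N_i}$ denotes the subvector of $x$ with indices in $N_i$. The Perron root $\rho(B)$ of a nonnegative square matrix $B$ is the largest eigenvalue of $B$ in the chosen setting: in setting (N) it is the usual spectral radius; in setting (M) it is the maximum geometric cycle mean $\max\{(b_{i_1i_2}b_{i_2i_3}\cdots b_{i_ki_1})^{1/k}\}$ over all $k\ge1$ and all indices $i_1,\dots,i_k$. A number $\lambda$ is an eigenvalue of $A$ if there is a nonzero $v\in\mathbb{R}_+^n$ with $Av=\lambda v$ in the chosen setting.
   Formalization: The equivalence of (i) with (iii), (iv), (v) is stated only for λ>0: at λ=0 the quotients by λ are undefined and (i)⇔(v) fails (e.g. setting (N), b=0); at λ=0 only (i)⇔(ii) and (a), (b) under (i), with x^0 read as 0, are stated. *)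

theory Defs
  imports
    "Jordan_Normal_Form.Matrix"
    "Jordan_Normal_Form.DL_Submatrix"
    "Jordan_Normal_Form.Spectral_Radius"
begin

text \<open>
  Matrices and vectors are those of \<^theory>\<open>Jordan_Normal_Form.Matrix\<close>, so indices run over
  0, ..., n-1 and the classes of a Frobenius normal form are numbered 0, ..., s-1.  Their entries
  are reals; nonnegativity is expressed by the entrywise order of that theory.
\<close>

datatype setting = MaxTimes | Nonneg

section \<open>Linear algebra in the two settings\<close>

fun s_add :: "setting \<Rightarrow> real \<Rightarrow> real \<Rightarrow> real" where
  "s_add MaxTimes a b = max a b"
| "s_add Nonneg a b = a + b"

text \<open>The 0 below is the neutral element of max on the nonnegative reals, i.e. the empty sum.\<close>

fun s_sum :: "setting \<Rightarrow> (nat \<Rightarrow> real) \<Rightarrow> nat set \<Rightarrow> real" where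
  "s_sum MaxTimes f K = Max (insert 0 (f ` K))"
| "s_sum Nonneg f K = sum f K"

definition s_add_vec :: "setting \<Rightarrow> real vec \<Rightarrow> real vec \<Rightarrow> real vec" where
  "s_add_vec st x y = vec (dim_vec y) (\<lambda>i. s_add st (x $ i) (y $ i))"

definition s_mult_mat :: "setting \<Rightarrow> real mat \<Rightarrow> real mat \<Rightarrow> real mat" where
  "s_mult_mat st A B = mat (dim_row A) (dim_col B)
     (\<lambda>(i, k). s_sum st (\<lambda>j. A $$ (i, j) * B $$ (j, k)) {0..<dim_row B})"

definition s_mult_mat_vec :: "setting \<Rightarrow> real mat \<Rightarrow> real vec \<Rightarrow> real vec" where
  "s_mult_mat_vec st A x = vec (dim_row A)
     (\<lambda>i. s_sum st (\<lambda>j. A $$ (i, j) * x $ j) {0..<dim_vec x})"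

fun s_pow_mat :: "setting \<Rightarrow> real mat \<Rightarrow> nat \<Rightarrow> real mat" where
  "s_pow_mat st A 0 = 1\<^sub>m (dim_row A)"
| "s_pow_mat st A (Suc k) = s_mult_mat st (s_pow_mat st A k) A"

lemma s_add_vec_Nonneg: "s_add_vec Nonneg x y = x + y"
  by (auto simp: s_add_vec_def)

lemma s_mult_mat_Nonneg: "dim_col A = dim_row B \<Longrightarrow> s_mult_mat Nonneg A B = A * B"
  by (rule eq_matI) (auto simp: s_mult_mat_def scalar_prod_def)

lemma s_mult_mat_vec_Nonneg: "dim_col A = dim_vec x \<Longrightarrow> s_mult_mat_vec Nonneg A x = A *\<^sub>v x"
  by (rule eq_vecI) (auto simp: s_mult_mat_vec_def scalar_prod_def)

lemma s_pow_mat_Nonneg: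
  assumes "A \<in> carrier_mat n n"
  shows "s_pow_mat Nonneg A k = A ^\<^sub>m k"
proof (induction k)
  case 0
  show ?case using assms by simp
next
  case (Suc k)
  have "A ^\<^sub>m k \<in> carrier_mat n n" using assms by (rule pow_carrier_mat)
  with Suc assms show ?case by (simp add: s_mult_mat_Nonneg)
qed

section \<open>Kleene stars\<close>

text \<open>Entrywise, I + B + ... + B^k.\<close>

definition star_partial :: "setting \<Rightarrow> real mat \<Rightarrow> nat \<Rightarrow> real mat" where
  "star_partial st B k = mat (dim_row B) (dim_row B)
     (\<lambda>ij. s_sum st (\<lambda>l. s_pow_mat st B l $$ ij) {0..k})"

definition star_converges :: "setting \<Rightarrow> real mat \<Rightarrow> bool" where
  "star_converges st B \<longleftrightarrow>
     (\<forall>i < dim_row B. \<forall>j < dim_row B. bdd_above (range (\<lambda>k. star_partial st B k $$ (i, j))))"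

text \<open>Entrywise, c + B c + ... + B^(k-1) c.\<close>

definition star_vec_partial :: "setting \<Rightarrow> real mat \<Rightarrow> real vec \<Rightarrow> nat \<Rightarrow> real vec" where
  "star_vec_partial st B c k = vec (dim_vec c)
     (\<lambda>i. s_sum st (\<lambda>l. s_mult_mat_vec st (s_pow_mat st B l) c $ i) {0..<k})"

definition star_vec_converges :: "setting \<Rightarrow> real mat \<Rightarrow> real vec \<Rightarrow> bool" where
  "star_vec_converges st B c \<longleftrightarrow>
     (\<forall>i < dim_vec c. bdd_above ((\<lambda>k. star_vec_partial st B c k $ i) ` {1..}))"

text \<open>A supremum of reals, hence meaningful only under \<^const>\<open>star_vec_converges\<close>.\<close>

definition star_vec :: "setting \<Rightarrow> real mat \<Rightarrow> real vec \<Rightarrow> real vec" where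
  "star_vec st B c = vec (dim_vec c) (\<lambda>i. SUP k\<in>{1..}. star_vec_partial st B c k $ i)"

text \<open>
  The quotients by lam.  They are undefined in mathematics for lam = 0, where HOL's convention
  a / 0 = 0 makes them zero.
\<close>

definition mat_div :: "real mat \<Rightarrow> real \<Rightarrow> real mat" where
  "mat_div A lam = map_mat (\<lambda>a. a / lam) A"

definition vec_div :: "real vec \<Rightarrow> real \<Rightarrow> real vec" where
  "vec_div b lam = map_vec (\<lambda>a. a / lam) b"

section \<open>Digraphs and the Frobenius normal form\<close>

definition arcs :: "real mat \<Rightarrow> (nat \<times> nat) set" where
  "arcs A = {(i, j). i < dim_row A \<and> j < dim_col A \<and> A $$ (i, j) > 0}"

definition accesses :: "real mat \<Rightarrow> nat \<Rightarrow> nat \<Rightarrow> bool" where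
  "accesses A i j \<longleftrightarrow> (i, j) \<in> (arcs A)\<^sup>*"

definition set_accesses :: "real mat \<Rightarrow> nat set \<Rightarrow> nat set \<Rightarrow> bool" where
  "set_accesses A I K \<longleftrightarrow> (\<exists>i\<in>I. \<exists>k\<in>K. accesses A i k)"

definition irreducible_mat :: "real mat \<Rightarrow> bool" where
  "irreducible_mat B \<longleftrightarrow>
     dim_row B = 1 \<or> (\<forall>i < dim_row B. \<forall>j < dim_row B. accesses B i j)"

text \<open>
  The classes N 0, ..., N (s-1) are the consecutive nonempty intervals cut out by
  0 = m 0 < m 1 < ... < m s = n; the values of N outside {0..<s} are irrelevant.
\<close>

definition frobenius_normal_form :: "real mat \<Rightarrow> nat \<Rightarrow> (nat \<Rightarrow> nat set) \<Rightarrow> bool" where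
  "frobenius_normal_form A s N \<longleftrightarrow>
     (\<exists>m. m 0 = 0 \<and> m s = dim_row A \<and> (\<forall>j<s. m j < m (Suc j) \<and> N j = {m j..<m (Suc j)})) \<and>
     (\<forall>i<s. \<forall>j<s. i < j \<longrightarrow> submatrix A (N i) (N j) = 0\<^sub>m (card (N i)) (card (N j))) \<and>
     (\<forall>j<s. irreducible_mat (submatrix A (N j) (N j)))"

definition supp :: "real vec \<Rightarrow> nat set" where
  "supp b = {i. i < dim_vec b \<and> b $ i \<noteq> 0}"

section \<open>Perron roots and eigenvalues\<close>

text \<open>Geometric mean of the closed walk through the nonempty list \<open>p\<close> of nodes.\<close>

definition cycle_mean :: "real mat \<Rightarrow> nat list \<Rightarrow> real" where
  "cycle_mean B p =
     root (length p) (\<Prod>l<length p. B $$ (p ! l, p ! (Suc l mod length p)))"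

text \<open>
  In the max-times setting the maximum ranges over the cycle means of closed walks of every length,
  possibly infinitely many values, for which \<^const>\<open>Max\<close> is unspecified; \<^const>\<open>Sup\<close> is attained
  by a simple cycle when the matrix is nonnegative and nonempty.
\<close>

fun perron_root :: "setting \<Rightarrow> real mat \<Rightarrow> real" where
  "perron_root MaxTimes B = (SUP p\<in>{p. p \<noteq> [] \<and> set p \<subseteq> {0..<dim_row B}}. cycle_mean B p)"
| "perron_root Nonneg B = spectral_radius (map_mat complex_of_real B)"

definition s_eigenvalue :: "setting \<Rightarrow> real mat \<Rightarrow> real \<Rightarrow> bool" where
  "s_eigenvalue st A lam \<longleftrightarrow>
     (\<exists>v \<in> carrier_vec (dim_row A). 0\<^sub>v (dim_row A) \<le> v \<and> v \<noteq> 0\<^sub>v (dim_row A) \<and>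
        s_mult_mat_vec st A v = lam \<cdot>\<^sub>v v)"

section \<open>The system and its solutions\<close>

definition is_solution :: "setting \<Rightarrow> real mat \<Rightarrow> real vec \<Rightarrow> real \<Rightarrow> real vec \<Rightarrow> bool" where
  "is_solution st A b lam x \<longleftrightarrow>
     x \<in> carrier_vec (dim_vec b) \<and> 0\<^sub>v (dim_vec b) \<le> x \<and>
     lam \<cdot>\<^sub>v x = s_add_vec st (s_mult_mat_vec st A x) b"

definition is_least_solution :: "setting \<Rightarrow> real mat \<Rightarrow> real vec \<Rightarrow> real \<Rightarrow> real vec \<Rightarrow> bool" where
  "is_least_solution st A b lam x \<longleftrightarrow>
     is_solution st A b lam x \<and> (\<forall>y. is_solution st A b lam y \<longrightarrow> x \<le> y)"

definition accessing_classes :: "real mat \<Rightarrow> real vec \<Rightarrow> nat \<Rightarrow> (nat \<Rightarrow> nat set) \<Rightarrow> nat set" where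
  "accessing_classes A b s N = {j. j < s \<and> set_accesses A (N j) (supp b)}"

definition max_perron_root :: "setting \<Rightarrow> real mat \<Rightarrow> (nat \<Rightarrow> nat set) \<Rightarrow> nat set \<Rightarrow> real" where
  "max_perron_root st A N J =
     (if J = {} then 0 else Max ((\<lambda>j. perron_root st (submatrix A (N j) (N j))) ` J))"

end

theory Submission
  imports Defs
begin

text \<open>
  Both settings are treated at once.  The arguments use only that addition is commutative,
  associative, monotone and continuous, that it has 0 as its least and neutral element on the
  nonnegative reals, and that multiplication distributes over it.  Max and plus share these
  properties; they part company only in the comparison of a Kleene star with a Perron root.

  Let \<open>lam > 0\<close> and divide by it.  The system becomes the fixed-point equation x = A' x + b' with
  A' = A / lam and b' = b / lam, and the partial sums b' + A' b' + ... + A'^(k-1) b' are the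
  iterates of this equation that start at 0 (\<open>picard_eq_sum\<close>).  They increase and stay below
  every solution, so a solution forces them to converge.  If they converge, then the limit is a
  solution by continuity, hence the least one (\<open>x0_least_solution\<close>).  Any solution satisfies
  x = A'^k x + (k-th partial sum); as A' x \<le> x, the vectors A'^k x decrease to some v with
  A' v = v, which gives x = x0 + v (\<open>solution_decomposition\<close>).  Scaling an eigenvector v so that
  one of its entries exceeds the corresponding entry of x0 makes x0 + v differ from x0 in the
  max-times setting too, which yields the criterion for uniqueness (\<open>unique_solution_iff\<close>).

  The series for x0 converges if and only if the star of every class with access to the support
  of b converges (\<open>converges_iff_class_stars\<close>).  If r is in such a class and leads to t in the
  support, then (A'^l)_pr (A'^m)_rt b'_t is bounded by a term of the series for x0_p, and a fixed m
  makes the last two factors positive, so the star of the class inherits the bound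
  (\<open>class_star_bounded\<close>).  Conversely, A being block triangular, the iterates are bounded class by
  class: once the earlier classes are bounded, their contribution to the next class is at most a
  constant right-hand side, and the star of that class turns this constant into a bound
  (\<open>picard_bounded_blockwise\<close>).  Classes without access carry only zeros.

  The star of a single block is compared with its Perron root separately.  In the max-times setting
  a closed walk of weight greater than 1 makes the powers unbounded, and if there is none, then
  closed subwalks can be removed until a walk is at most as long as the number of nodes
  (\<open>kpow_MaxTimes_bounded_iff\<close>).  In the usual algebra convergence makes the powers tend to 0, so
  no complex eigenvalue of the scaled block has modulus at least 1; if the spectral radius is less
  than r < lam, then the powers of the block divided by r are bounded and the star is dominated by
  a geometric series.

  For \<open>lam = 0\<close> a solution exists only if b = 0; then x0 = 0 and the solutions are the nonnegative
  vectors that A annihilates.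
\<close>

section \<open>Sums in the two settings\<close>

lemma s_add_commute: "s_add st x y = s_add st y x"
  by (cases st) auto

lemma s_add_assoc: "s_add st (s_add st x y) z = s_add st x (s_add st y z)"
  by (cases st) auto

lemma s_add_left_commute: "s_add st x (s_add st y z) = s_add st y (s_add st x z)"
  by (cases st) auto

lemmas s_add_ac = s_add_assoc s_add_commute s_add_left_commute

lemma s_add_zero [simp]: "0 \<le> x \<Longrightarrow> s_add st 0 x = x" "0 \<le> x \<Longrightarrow> s_add st x 0 = x"
  by (cases st; simp)+

lemma s_add_nonneg: "0 \<le> x \<Longrightarrow> 0 \<le> y \<Longrightarrow> 0 \<le> s_add st x y"
  by (cases st) auto

lemma s_add_mono: "x \<le> x' \<Longrightarrow> y \<le> y' \<Longrightarrow> s_add st x y \<le> s_add st x' y'"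
  by (cases st) auto

lemma s_add_upper: "0 \<le> y \<Longrightarrow> x \<le> s_add st x y" "0 \<le> x \<Longrightarrow> y \<le> s_add st x y"
  by (cases st; simp)+

lemma s_add_distrib_left: "0 \<le> c \<Longrightarrow> c * s_add st x y = s_add st (c * x) (c * y)"
  by (cases st) (auto simp: distrib_left max_mult_distrib_left)

lemma tendsto_s_add:
  "(f \<longlongrightarrow> x) F \<Longrightarrow> (g \<longlongrightarrow> y) F \<Longrightarrow> ((\<lambda>k. s_add st (f k) (g k)) \<longlongrightarrow> s_add st x y) F"
  by (cases st) (auto intro: tendsto_intros tendsto_max)

lemma s_sum_empty [simp]: "s_sum st f {} = 0"
  by (cases st) auto

lemma s_sum_insert:
  assumes "finite K" "x \<notin> K"
  shows "s_sum st f (insert x K) = s_add st (f x) (s_sum st f K)"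
proof (cases st)
  case MaxTimes
  have "insert 0 (f ` insert x K) = insert (f x) (insert 0 (f ` K))" by auto
  with MaxTimes assms show ?thesis by simp
qed (use assms in simp)

lemma s_sum_cong:
  assumes "\<And>x. x \<in> K \<Longrightarrow> f x = g x"
  shows "s_sum st f K = s_sum st g K"
proof (cases st)
  case MaxTimes
  have "f ` K = g ` K" using assms by (rule image_cong[OF refl])
  with MaxTimes show ?thesis by simp
qed (use assms in auto)

lemma s_sum_reindex:
  assumes "inj_on h K"
  shows "s_sum st f (h ` K) = s_sum st (\<lambda>x. f (h x)) K"
  by (cases st) (auto simp: image_image sum.reindex[OF assms] o_def)

lemma s_sum_nonneg:
  assumes "finite K" "\<And>x. x \<in> K \<Longrightarrow> 0 \<le> f x"
  shows "0 \<le> s_sum st f K"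
  using assms by (cases st) (auto simp: sum_nonneg)

lemma s_sum_zero:
  assumes "finite K" "\<And>x. x \<in> K \<Longrightarrow> f x = 0"
  shows "s_sum st f K = 0"
  using assms by (induction K rule: finite_induct) (simp_all add: s_sum_insert)

lemma s_sum_mono:
  assumes "finite K" "\<And>x. x \<in> K \<Longrightarrow> f x \<le> g x"
  shows "s_sum st f K \<le> s_sum st g K"
  using assms
  by (induction K rule: finite_induct) (auto simp: s_sum_insert intro!: s_add_mono)

lemma s_sum_Un:
  assumes "finite K" "finite L" "K \<inter> L = {}" "\<And>x. x \<in> L \<Longrightarrow> 0 \<le> f x"
  shows "s_sum st f (K \<union> L) = s_add st (s_sum st f K) (s_sum st f L)"
  using assms(1,3)
proof (induction K rule: finite_induct)
  case empty
  show ?case using assms s_sum_nonneg[of L f st] by simp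
next
  case (insert x K)
  then show ?case using assms(2) by (simp add: s_sum_insert s_add_assoc)
qed

lemma s_sum_subset_le:
  assumes "finite L" "K \<subseteq> L" "\<And>x. x \<in> L \<Longrightarrow> 0 \<le> f x"
  shows "s_sum st f K \<le> s_sum st f L"
proof -
  have "finite K" using assms finite_subset by blast
  with assms have "s_sum st f (K \<union> (L - K)) = s_add st (s_sum st f K) (s_sum st f (L - K))"
    by (intro s_sum_Un) auto
  moreover have "K \<union> (L - K) = L" using assms(2) by auto
  moreover have "0 \<le> s_sum st f (L - K)" using assms by (auto intro: s_sum_nonneg)
  ultimately show ?thesis by (simp add: s_add_upper)
qed

text \<open>
  Only an inequality: a summand common to both sets is counted twice on the right.
\<close>

lemma s_sum_Un_le:
  assumes "finite K" "finite L" "\<And>x. x \<in> K \<union> L \<Longrightarrow> 0 \<le> f x"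
  shows "s_sum st f (K \<union> L) \<le> s_add st (s_sum st f K) (s_sum st f L)"
proof -
  have "s_sum st f (K \<union> L) = s_sum st f (K \<union> (L - K))" by simp
  also have "\<dots> = s_add st (s_sum st f K) (s_sum st f (L - K))"
    using assms by (intro s_sum_Un) auto
  also have "\<dots> \<le> s_add st (s_sum st f K) (s_sum st f L)"
    using assms by (intro s_add_mono s_sum_subset_le) auto
  finally show ?thesis .
qed

lemma s_sum_member_le:
  assumes "finite K" "x \<in> K" "\<And>x. x \<in> K \<Longrightarrow> 0 \<le> f x"
  shows "f x \<le> s_sum st f K"
  using s_sum_subset_le[of K "{x}" f st] assms s_sum_insert[of "{}" x st f] by simp

lemma s_sum_distrib_left:
  assumes "finite K" "0 \<le> c"
  shows "c * s_sum st f K = s_sum st (\<lambda>x. c * f x) K"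
  using assms
  by (induction K rule: finite_induct) (simp_all add: s_sum_insert s_add_distrib_left)

lemma s_sum_distrib_right:
  assumes "finite K" "0 \<le> c"
  shows "s_sum st f K * c = s_sum st (\<lambda>x. f x * c) K"
  using s_sum_distrib_left[OF assms, of st f] by (simp add: mult.commute)

lemma s_sum_s_add:
  assumes "finite K"
  shows "s_sum st (\<lambda>x. s_add st (f x) (g x)) K = s_add st (s_sum st f K) (s_sum st g K)"
  using assms by (induction K rule: finite_induct) (simp_all add: s_sum_insert s_add_ac)

lemma s_sum_swap:
  assumes "finite K" "finite L"
  shows "s_sum st (\<lambda>x. s_sum st (\<lambda>y. f x y) L) K = s_sum st (\<lambda>y. s_sum st (\<lambda>x. f x y) K) L"
  using assms(1)
proof (induction K rule: finite_induct)
  case empty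
  show ?case using s_sum_zero[OF assms(2)] by simp
next
  case (insert x K)
  then show ?case using s_sum_s_add[OF assms(2)] by (simp add: s_sum_insert)
qed

lemma s_sum_delta:
  assumes "finite K" "i \<in> K" "0 \<le> c i"
  shows "s_sum st (\<lambda>j. (if i = j then 1 else 0) * c j) K = c i"
proof -
  let ?f = "\<lambda>j. (if i = j then 1 else 0) * c j"
  have "s_sum st ?f K = s_sum st ?f (insert i (K - {i}))"
    using assms(2) by (simp add: insert_absorb)
  also have "\<dots> = s_add st (c i) (s_sum st ?f (K - {i}))"
    using assms(1) by (subst s_sum_insert) auto
  also have "s_sum st ?f (K - {i}) = 0"
    using assms by (intro s_sum_zero) auto
  finally show ?thesis using assms by simp
qed

lemma tendsto_s_sum:
  assumes "finite K" "\<And>j. j \<in> K \<Longrightarrow> ((\<lambda>k. f k j) \<longlongrightarrow> g j) F"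
  shows "((\<lambda>k. s_sum st (f k) K) \<longlongrightarrow> s_sum st g K) F"
  using assms
  by (induction K rule: finite_induct) (auto simp: s_sum_insert intro!: tendsto_s_add)

section \<open>Powers of a nonnegative matrix\<close>

text \<open>
  Powers of the submatrix of \<open>a\<close> with rows and columns in \<open>S\<close>.  Keeping the
  original indices, instead of renumbering the rows of a submatrix, lets powers of a class and
  powers of the whole matrix be compared directly.
\<close>

fun kpow :: "setting \<Rightarrow> (nat \<Rightarrow> nat \<Rightarrow> real) \<Rightarrow> nat set \<Rightarrow> nat \<Rightarrow> nat \<Rightarrow> nat \<Rightarrow> real" where
  "kpow st a S 0 i j = (if i = j then 1 else 0)"
| "kpow st a S (Suc l) i j = s_sum st (\<lambda>k. kpow st a S l i k * a k j) S"

lemma kpow_reindex: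
  assumes "inj_on h S" "i \<in> S" "j \<in> S"
  shows "kpow st a (h ` S) l (h i) (h j) = kpow st (\<lambda>i j. a (h i) (h j)) S l i j"
  using assms(3)
proof (induction l arbitrary: j)
  case 0
  then show ?case using assms inj_on_eq_iff[of h S i j] by simp
next
  case (Suc l)
  then show ?case using assms by (auto simp: s_sum_reindex intro!: s_sum_cong)
qed

lemma kpow_scale:
  assumes "finite S" "0 \<le> c"
  shows "kpow st (\<lambda>i j. c * a i j) S l i j = c ^ l * kpow st a S l i j"
proof (induction l arbitrary: j)
  case (Suc l)
  have "kpow st (\<lambda>i j. c * a i j) S (Suc l) i j = s_sum st (\<lambda>k. c ^ Suc l * (kpow st a S l i k * a k j)) S"
    by (auto simp: Suc mult_ac intro!: s_sum_cong)
  then show ?case using assms by (simp add: s_sum_distrib_left)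
qed simp

locale nonneg_matrix =
  fixes st :: setting and a :: "nat \<Rightarrow> nat \<Rightarrow> real" and S :: "nat set"
  assumes fin: "finite S"
    and a_nonneg: "i \<in> S \<Longrightarrow> j \<in> S \<Longrightarrow> 0 \<le> a i j"
begin

abbreviation "pw \<equiv> kpow st a S"

lemma kpow_nonneg:
  assumes "i \<in> S" "j \<in> S"
  shows "0 \<le> pw l i j"
  using assms(2)
proof (induction l arbitrary: j)
  case (Suc l)
  then show ?case by (auto intro!: s_sum_nonneg fin mult_nonneg_nonneg a_nonneg)
qed simp

lemma kpow_Suc_left:
  assumes "i \<in> S" "j \<in> S"
  shows "pw (Suc l) i j = s_sum st (\<lambda>k. a i k * pw l k j) S"
  using assms(2)
proof (induction l arbitrary: j)
  case 0
  have "pw (Suc 0) i j = a i j"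
    using s_sum_delta[OF fin assms(1), of "\<lambda>k. a k j" st] a_nonneg[OF assms(1) 0] by simp
  also have "\<dots> = s_sum st (\<lambda>k. (if j = k then 1 else 0) * a i k) S"
    using s_sum_delta[OF fin 0, of "\<lambda>k. a i k" st] a_nonneg[OF assms(1) 0] by simp
  also have "\<dots> = s_sum st (\<lambda>k. a i k * pw 0 k j) S"
    by (rule s_sum_cong) auto
  finally show ?case .
next
  case (Suc l)
  have "pw (Suc (Suc l)) i j = s_sum st (\<lambda>k. pw (Suc l) i k * a k j) S" by simp
  also have "\<dots> = s_sum st (\<lambda>k. s_sum st (\<lambda>q. a i q * (pw l q k * a k j)) S) S"
    using Suc fin a_nonneg
    by (intro s_sum_cong) (simp only: Suc.IH s_sum_distrib_right mult.assoc)
  also have "\<dots> = s_sum st (\<lambda>q. s_sum st (\<lambda>k. a i q * (pw l q k * a k j)) S) S"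
    using fin by (intro s_sum_swap)
  also have "\<dots> = s_sum st (\<lambda>q. a i q * pw (Suc l) q j) S"
    using assms(1) fin a_nonneg by (intro s_sum_cong) (simp add: s_sum_distrib_left)
  finally show ?case .
qed

text \<open>
  A walk from i to k followed by one from k to j is a walk from i to j, and every omitted summand is
  nonnegative.
\<close>

lemma kpow_mult_le:
  assumes "i \<in> S" "k \<in> S" "j \<in> S"
  shows "pw m i k * pw l k j \<le> pw (m + l) i j"
  using assms(3)
proof (induction l arbitrary: j)
  case 0
  then show ?case using assms kpow_nonneg by auto
next
  case (Suc l)
  have "pw m i k * pw (Suc l) k j = s_sum st (\<lambda>q. (pw m i k * pw l k q) * a q j) S"
    using assms kpow_nonneg fin by (simp add: s_sum_distrib_left mult.assoc)
  also have "\<dots> \<le> s_sum st (\<lambda>q. pw (m + l) i q * a q j) S"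
    using Suc a_nonneg by (intro s_sum_mono fin mult_right_mono) auto
  finally show ?case by simp
qed

lemma kpow_mono_set:
  assumes "T \<subseteq> S" "i \<in> T" "j \<in> T"
  shows "kpow st a T l i j \<le> pw l i j"
  using assms(3)
proof (induction l arbitrary: j)
  case (Suc l)
  have "kpow st a T (Suc l) i j \<le> s_sum st (\<lambda>k. pw l i k * a k j) T"
    using Suc a_nonneg assms(1) finite_subset[OF assms(1) fin]
    by (auto intro!: s_sum_mono mult_right_mono)
  also have "\<dots> \<le> s_sum st (\<lambda>k. pw l i k * a k j) S"
    using assms Suc.prems a_nonneg kpow_nonneg
    by (intro s_sum_subset_le fin mult_nonneg_nonneg) auto
  finally show ?case by simp
qed simp

abbreviation "edges \<equiv> {(i, j). i \<in> S \<and> j \<in> S \<and> 0 < a i j}"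

lemma kpow_pos_if_path:
  assumes "(i, j) \<in> edges\<^sup>*" "i \<in> S"
  shows "j \<in> S \<and> (\<exists>l. 0 < pw l i j)"
  using assms(1)
proof (induction rule: rtrancl_induct)
  case base
  show ?case using assms(2) by (auto intro: exI[of _ 0])
next
  case (step j k)
  then obtain l where l: "0 < pw l i j" and j: "j \<in> S" by auto
  have "0 < pw l i j * a j k" using l step by simp
  also have "\<dots> \<le> pw (Suc l) i k"
    using step j assms(2) kpow_nonneg a_nonneg s_sum_member_le[OF fin j, of "\<lambda>q. pw l i q * a q k" st] by auto
  finally show ?case using step by blast
qed

end

section \<open>Least solutions of fixed-point systems\<close>

fun picard :: "setting \<Rightarrow> (nat \<Rightarrow> nat \<Rightarrow> real) \<Rightarrow> nat set \<Rightarrow> (nat \<Rightarrow> real) \<Rightarrow> nat \<Rightarrow> nat \<Rightarrow> real" where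
  "picard st a S c 0 i = 0"
| "picard st a S c (Suc k) i = s_add st (s_sum st (\<lambda>j. a i j * picard st a S c k j) S) (c i)"

locale nonneg_system = nonneg_matrix +
  fixes c :: "nat \<Rightarrow> real"
  assumes c_nonneg: "i \<in> S \<Longrightarrow> 0 \<le> c i"
begin

abbreviation "pic \<equiv> picard st a S c"

lemma picard_nonneg: "i \<in> S \<Longrightarrow> 0 \<le> pic k i"
proof (induction k arbitrary: i)
  case (Suc k)
  then show ?case
    by (auto intro!: s_add_nonneg s_sum_nonneg fin mult_nonneg_nonneg a_nonneg c_nonneg)
qed simp

text \<open>
  Unfolding the iteration from the left, c + a (c + a c + ...), is distributivity and an exchange of
  the order of summation.  This identifies the iterates with the partial sums of the star series.
\<close>

lemma picard_eq_sum:
  assumes "i \<in> S"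
  shows "pic k i = s_sum st (\<lambda>l. s_sum st (\<lambda>j. pw l i j * c j) S) {0..<k}"
  using assms
proof (induction k arbitrary: i)
  case (Suc k)
  define t where "t l i = s_sum st (\<lambda>j. pw l i j * c j) S" for l i
  have t0: "t 0 i = c i"
    unfolding t_def using s_sum_delta[of S i c st] fin Suc.prems c_nonneg by simp
  have tSuc: "t (Suc l) i = s_sum st (\<lambda>q. a i q * t l q) S" for l
  proof -
    have "t (Suc l) i = s_sum st (\<lambda>j. s_sum st (\<lambda>q. a i q * (pw l q j * c j)) S) S"
      unfolding t_def using Suc.prems c_nonneg fin
      by (intro s_sum_cong) (simp only: kpow_Suc_left s_sum_distrib_right mult.assoc)
    also have "\<dots> = s_sum st (\<lambda>q. s_sum st (\<lambda>j. a i q * (pw l q j * c j)) S) S"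
      by (intro s_sum_swap fin)
    also have "\<dots> = s_sum st (\<lambda>q. a i q * t l q) S"
      unfolding t_def using Suc.prems a_nonneg fin
      by (intro s_sum_cong) (simp add: s_sum_distrib_left)
    finally show ?thesis .
  qed
  have "s_sum st (\<lambda>l. t l i) {0..<Suc k} = s_sum st (\<lambda>l. t l i) (insert 0 (Suc ` {0..<k}))"
    by (simp only: image_Suc_atLeastLessThan atLeast0_lessThan_Suc_eq_insert_0)
  also have "\<dots> = s_add st (t 0 i) (s_sum st (\<lambda>l. t (Suc l) i) {0..<k})"
    by (simp only: s_sum_reindex[OF inj_Suc] s_sum_insert finite_imageI finite_atLeastLessThan
        zero_notin_Suc_image not_False_eq_True)
  also have "s_sum st (\<lambda>l. t (Suc l) i) {0..<k} =
      s_sum st (\<lambda>q. s_sum st (\<lambda>l. a i q * t l q) {0..<k}) S"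
    by (simp only: tSuc) (intro s_sum_swap fin finite_atLeastLessThan)
  also have "\<dots> = s_sum st (\<lambda>q. a i q * pic k q) S"
    using Suc a_nonneg by (intro s_sum_cong) (simp add: s_sum_distrib_left t_def)
  finally show ?case unfolding t0 by (simp add: t_def s_add_commute[of st "c i"])
qed simp

lemma picard_le_supersolution:
  assumes "\<And>i. i \<in> S \<Longrightarrow> 0 \<le> x i"
    and "\<And>i. i \<in> S \<Longrightarrow> s_add st (s_sum st (\<lambda>j. a i j * x j) S) (c i) \<le> x i"
  shows "i \<in> S \<Longrightarrow> pic k i \<le> x i"
proof (induction k arbitrary: i)
  case (Suc k)
  have "pic (Suc k) i \<le> s_add st (s_sum st (\<lambda>j. a i j * x j) S) (c i)"
    using Suc a_nonneg by (auto intro!: s_add_mono s_sum_mono fin mult_left_mono)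
  with assms(2)[OF Suc.prems] show ?case by linarith
qed (simp add: assms)

lemma picard_incseq:
  assumes "i \<in> S"
  shows "incseq (\<lambda>k. pic k i)"
proof (rule incseq_SucI)
  show "pic k i \<le> pic (Suc k) i" for k
    using assms
  proof (induction k arbitrary: i)
    case 0
    then show ?case using picard_nonneg[of i "Suc 0"] by simp
  next
    case (Suc k)
    then have "s_sum st (\<lambda>j. a i j * pic k j) S \<le> s_sum st (\<lambda>j. a i j * pic (Suc k) j) S"
      using a_nonneg by (intro s_sum_mono fin mult_left_mono)
    then show ?case unfolding picard.simps(2)[of _ _ _ _ k] picard.simps(2)[of _ _ _ _ "Suc k"]
      by (rule s_add_mono) simp
  qed
qed

lemma picard_limit_fixpoint:
  assumes "\<And>i. i \<in> S \<Longrightarrow> (\<lambda>k. pic k i) \<longlonglongrightarrow> y i" and "i \<in> S"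
  shows "y i = s_add st (s_sum st (\<lambda>j. a i j * y j) S) (c i)"
proof -
  have "(\<lambda>k. pic (Suc k) i) \<longlonglongrightarrow> s_add st (s_sum st (\<lambda>j. a i j * y j) S) (c i)"
    unfolding picard.simps by (intro tendsto_s_add tendsto_s_sum fin tendsto_intros assms)
  moreover have "(\<lambda>k. pic (Suc k) i) \<longlonglongrightarrow> y i"
    using assms by (intro LIMSEQ_Suc) auto
  ultimately show ?thesis using LIMSEQ_unique by blast
qed

lemma picard_tendsto_SUP:
  assumes "i \<in> S" "bdd_above ((\<lambda>k. pic k i) ` {1..})"
  shows "(\<lambda>k. pic k i) \<longlonglongrightarrow> (SUP k\<in>{1..}. pic k i)"
proof -
  have "{1::nat..} = range Suc" by (auto dest: Suc_le_D)
  then have r: "(\<lambda>k. pic k i) ` {1..} = range (\<lambda>k. pic (Suc k) i)"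
    by (simp only: image_image)
  have "(\<lambda>k. pic (Suc k) i) \<longlonglongrightarrow> (SUP k. pic (Suc k) i)"
  proof (rule LIMSEQ_incseq_SUP)
    show "bdd_above (range (\<lambda>k. pic (Suc k) i))" using assms(2) unfolding r .
    show "incseq (\<lambda>k. pic (Suc k) i)"
      by (rule incseq_SucI) (rule incseq_SucD[OF picard_incseq[OF assms(1)]])
  qed
  then show ?thesis unfolding r by (rule LIMSEQ_imp_Suc)
qed

text \<open>
  The remainder a^k x in x = a^k x + (k-th iterate) decreases, because a x \<le> x.  Its limit is the
  vector v, and continuity of both operations carries the two equations to the limit.
\<close>

lemma solution_decomposition:
  assumes lim: "\<And>i. i \<in> S \<Longrightarrow> (\<lambda>k. pic k i) \<longlonglongrightarrow> y i"
    and x0: "\<And>i. i \<in> S \<Longrightarrow> 0 \<le> x i"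
    and sol: "\<And>i. i \<in> S \<Longrightarrow> x i = s_add st (s_sum st (\<lambda>j. a i j * x j) S) (c i)"
  obtains v where "\<And>i. i \<in> S \<Longrightarrow> 0 \<le> v i"
    and "\<And>i. i \<in> S \<Longrightarrow> s_sum st (\<lambda>j. a i j * v j) S = v i"
    and "\<And>i. i \<in> S \<Longrightarrow> x i = s_add st (y i) (v i)"
proof -
  \<comment> \<open>The remainder a^k x.\<close>
  define r where "r k = ((\<lambda>u i. s_sum st (\<lambda>j. a i j * u j) S) ^^ k) x" for k
  have r0: "r 0 = x" and rSuc: "r (Suc k) i = s_sum st (\<lambda>j. a i j * r k j) S" for k i
    by (simp_all add: r_def)
  have r_nonneg: "0 \<le> r k i" if "i \<in> S" for k i
    using that
    by (induction k arbitrary: i)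
      (auto simp: r0 rSuc x0 intro!: s_sum_nonneg fin mult_nonneg_nonneg a_nonneg)
  have r_dec: "r (Suc k) i \<le> r k i" if "i \<in> S" for k i
    using that
  proof (induction k arbitrary: i)
    case 0
    have "s_sum st (\<lambda>j. a i j * x j) S \<le> s_add st (s_sum st (\<lambda>j. a i j * x j) S) (c i)"
      using 0 c_nonneg by (intro s_add_upper)
    with sol[OF 0] show ?case by (simp add: rSuc r0)
  next
    case (Suc k)
    then show ?case
      unfolding rSuc[of "Suc k"] rSuc[of k i] using a_nonneg
      by (intro s_sum_mono fin mult_left_mono) auto
  qed
  have split: "x i = s_add st (r k i) (pic k i)" if "i \<in> S" for k i
    using that
  proof (induction k arbitrary: i)
    case 0
    then show ?case by (simp add: r0 x0)
  next
    case (Suc k)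
    have "s_sum st (\<lambda>j. a i j * x j) S = s_sum st (\<lambda>j. s_add st (a i j * r k j) (a i j * pic k j)) S"
      using Suc a_nonneg by (intro s_sum_cong) (simp add: s_add_distrib_left[symmetric])
    then show ?case
      using sol[OF Suc.prems] by (simp add: s_sum_s_add[OF fin] rSuc s_add_assoc)
  qed
  have conv: "\<exists>l. (\<lambda>k. r k i) \<longlonglongrightarrow> l" if "i \<in> S" for i
  proof -
    have "decseq (\<lambda>k. r k i)" using r_dec[OF that] by (rule decseq_SucI)
    then show ?thesis using decseq_convergent[of "\<lambda>k. r k i" 0] r_nonneg[OF that] by metis
  qed
  define v where "v i = lim (\<lambda>k. r k i)" for i
  have v: "(\<lambda>k. r k i) \<longlonglongrightarrow> v i" if "i \<in> S" for i
    using conv[OF that] by (auto simp: v_def limI)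
  show thesis
  proof
    fix i assume i: "i \<in> S"
    show "0 \<le> v i" using LIMSEQ_le_const[OF v[OF i]] r_nonneg[OF i] by blast
    have "(\<lambda>k. r (Suc k) i) \<longlonglongrightarrow> s_sum st (\<lambda>j. a i j * v j) S"
      unfolding rSuc by (intro tendsto_s_sum fin tendsto_intros v)
    with LIMSEQ_Suc[OF v[OF i]] show "s_sum st (\<lambda>j. a i j * v j) S = v i"
      using LIMSEQ_unique by blast
    have "(\<lambda>k. s_add st (r k i) (pic k i)) \<longlonglongrightarrow> s_add st (v i) (y i)"
      by (intro tendsto_s_add v lim i)
    then have "(\<lambda>k. x i) \<longlonglongrightarrow> s_add st (v i) (y i)"
      by (simp only: split[OF i, symmetric])
    then show "x i = s_add st (y i) (v i)"
      using LIMSEQ_unique[OF tendsto_const] by (metis s_add_commute)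
  qed
qed

end

section \<open>Convergence of the iterates class by class\<close>

context nonneg_system
begin

lemma kpow_le_picard:
  assumes "i \<in> S" "j \<in> S" "l < k"
  shows "pw l i j * c j \<le> pic k i"
proof -
  have "pw l i j * c j \<le> s_sum st (\<lambda>j. pw l i j * c j) S"
    using assms kpow_nonneg c_nonneg by (intro s_sum_member_le fin) auto
  also have "\<dots> \<le> s_sum st (\<lambda>l. s_sum st (\<lambda>j. pw l i j * c j) S) {0..<k}"
    using assms kpow_nonneg c_nonneg fin
      s_sum_member_le[of "{0..<k}" l "\<lambda>l. s_sum st (\<lambda>j. pw l i j * c j) S" st]
    by (simp add: s_sum_nonneg)
  finally show ?thesis using assms by (simp add: picard_eq_sum)
qed

lemma picard_pos_if_path:
  assumes "(i, t) \<in> edges\<^sup>*" "i \<in> S" "0 < c t"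
  shows "\<exists>k. 0 < pic k i"
proof -
  obtain l where "t \<in> S" "0 < pw l i t" using kpow_pos_if_path assms by blast
  with kpow_le_picard[of i t l "Suc l"] assms have "0 < pic (Suc l) i"
    by (smt (verit) lessI mult_pos_pos)
  then show ?thesis by blast
qed

text \<open>
  The nodes without access to the support of c are closed under arcs, so a zero there is
  preserved by each step of the iteration.
\<close>

lemma picard_zero_if_no_path:
  assumes "i \<in> S" "\<And>t. t \<in> S \<Longrightarrow> (i, t) \<in> edges\<^sup>* \<Longrightarrow> c t = 0"
  shows "pic k i = 0"
  using assms
proof (induction k arbitrary: i)
  case (Suc k)
  have "a i j * pic k j = 0" if "j \<in> S" for j
  proof (cases "0 < a i j")
    case True
    then have "(i, j) \<in> edges" using Suc.prems that by simp
    then have "pic k j = 0" using Suc.prems that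
      by (intro Suc.IH) (auto intro: converse_rtrancl_into_rtrancl)
    then show ?thesis by simp
  next
    case False
    then show ?thesis using a_nonneg[OF Suc.prems(1) that] by simp
  qed
  then have "s_sum st (\<lambda>j. a i j * pic k j) S = 0" by (intro s_sum_zero fin) auto
  then show ?case using Suc.prems by simp
qed simp

text \<open>
  Multiplying the star of the class by the fixed positive number w = (a^m)_rt c_t shifts it into
  the series for the iterates at p, because walks inside T from p to r extend to walks from p to t.
\<close>

lemma class_star_bounded:
  assumes T: "T \<subseteq> S" "p \<in> T" "r \<in> T"
    and path: "(r, t) \<in> edges\<^sup>*" and t: "0 < c t"
    and bdd: "bdd_above (range (\<lambda>k. pic k p))"
  shows "bdd_above (range (\<lambda>k. s_sum st (\<lambda>l. kpow st a T l p r) {0..k}))"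
proof -
  have pr: "p \<in> S" "r \<in> S" using T by auto
  obtain m where tS: "t \<in> S" and m: "0 < pw m r t" using kpow_pos_if_path[OF path pr(2)] by blast
  define w where "w = pw m r t * c t"
  have w: "0 < w" using m t by (simp add: w_def)
  obtain M where M: "pic k p \<le> M" for k using bdd by (auto simp: bdd_above_def)
  have "s_sum st (\<lambda>l. kpow st a T l p r) {0..k} \<le> M / w" for k
  proof -
    define u where "u l = s_sum st (\<lambda>j. pw l p j * c j) S" for l
    have u_nonneg: "0 \<le> u l" for l
      unfolding u_def using pr kpow_nonneg c_nonneg by (intro s_sum_nonneg fin mult_nonneg_nonneg)
    have "s_sum st (\<lambda>l. kpow st a T l p r) {0..k} * w = s_sum st (\<lambda>l. kpow st a T l p r * w) {0..k}"
      using w by (intro s_sum_distrib_right) auto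
    also have "\<dots> \<le> s_sum st (\<lambda>l. u (l + m)) {0..k}"
    proof (intro s_sum_mono)
      fix l
      have "kpow st a T l p r * w \<le> (pw l p r * pw m r t) * c t"
        unfolding w_def mult.assoc[symmetric] using m t kpow_mono_set[OF T, of l] by (intro mult_right_mono) auto
      also have "\<dots> \<le> pw (l + m) p t * c t"
        using kpow_mult_le[OF pr tS, of l m] t by (intro mult_right_mono) auto
      also have "\<dots> \<le> u (l + m)"
        unfolding u_def using pr tS kpow_nonneg c_nonneg by (intro s_sum_member_le fin) auto
      finally show "kpow st a T l p r * w \<le> u (l + m)" .
    qed simp
    also have "\<dots> = s_sum st u ((\<lambda>l. l + m) ` {0..k})"
      by (subst s_sum_reindex) auto
    also have "\<dots> \<le> s_sum st u {0..<Suc (k + m)}"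
      using u_nonneg by (intro s_sum_subset_le) auto
    also have "\<dots> = pic (Suc (k + m)) p"
      unfolding picard_eq_sum[OF pr(1)] by (intro s_sum_cong) (simp add: u_def)
    also have "\<dots> \<le> M" by (rule M)
    finally show ?thesis using w by (simp add: pos_le_divide_eq)
  qed
  then show ?thesis by (auto simp: bdd_above_def)
qed

text \<open>
  Exchanging the sums, the iterate at p is a combination of the entries of the star with the fixed
  weights \<open>c\<close>.
\<close>

lemma picard_bounded_if_star_bounded:
  assumes star: "\<And>p q. p \<in> S \<Longrightarrow> q \<in> S \<Longrightarrow> bdd_above (range (\<lambda>k. s_sum st (\<lambda>l. pw l p q) {0..k}))"
  obtains M where "0 \<le> M" "\<And>k p. p \<in> S \<Longrightarrow> pic k p \<le> M"
proof -
  have "\<forall>p q. \<exists>B. p \<in> S \<longrightarrow> q \<in> S \<longrightarrow> (\<forall>k. s_sum st (\<lambda>l. pw l p q) {0..k} \<le> B)"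
    using star by (fastforce simp: bdd_above_def)
  then obtain B where B: "s_sum st (\<lambda>l. pw l p q) {0..k} \<le> B p q"
    if "p \<in> S" "q \<in> S" for p q k by metis
  define D where "D p = s_sum st (\<lambda>q. B p q * c q) S" for p
  have le: "pic k p \<le> D p" if p: "p \<in> S" for k p
  proof -
    have "pic k p = s_sum st (\<lambda>q. s_sum st (\<lambda>l. pw l p q * c q) {0..<k}) S"
      using p fin by (simp add: picard_eq_sum s_sum_swap[of "{0..<k}" S])
    also have "\<dots> \<le> D p"
      unfolding D_def
    proof (intro s_sum_mono fin)
      fix q assume q: "q \<in> S"
      have "s_sum st (\<lambda>l. pw l p q * c q) {0..<k} = s_sum st (\<lambda>l. pw l p q) {0..<k} * c q"
        using q c_nonneg by (simp add: s_sum_distrib_right)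
      also have "s_sum st (\<lambda>l. pw l p q) {0..<k} \<le> s_sum st (\<lambda>l. pw l p q) {0..k}"
        using p q kpow_nonneg by (intro s_sum_subset_le) auto
      also have "\<dots> \<le> B p q" using p q by (rule B)
      finally show "s_sum st (\<lambda>l. pw l p q * c q) {0..<k} \<le> B p q * c q"
        using q c_nonneg by (auto simp: mult_right_mono)
    qed
    finally show ?thesis .
  qed
  have "pic k p \<le> (\<Sum>p\<in>S. \<bar>D p\<bar>)" if "p \<in> S" for k p
  proof -
    have "pic k p \<le> \<bar>D p\<bar>" using le[OF that, of k] by linarith
    also have "\<dots> \<le> (\<Sum>p\<in>S. \<bar>D p\<bar>)" using fin that by (intro member_le_sum) auto
    finally show ?thesis .
  qed
  then show thesis by (intro that[of "\<Sum>p\<in>S. \<bar>D p\<bar>"]) (auto intro: sum_nonneg)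
qed

text \<open>
  Induction on the number of classes treated.  Inside class i the values on earlier classes are at
  most a constant M, those on later classes have coefficient 0, and so the iterates of the whole
  system are dominated there by the iterates of the system of class i with the constant right-hand
  side \<open>d\<close>.
\<close>

lemma picard_bounded_blockwise:
  fixes s :: nat and N :: "nat \<Rightarrow> nat set"
  assumes S: "S = (\<Union>i<s. N i)"
    and tri: "\<And>i j p q. i < j \<Longrightarrow> j < s \<Longrightarrow> p \<in> N i \<Longrightarrow> q \<in> N j \<Longrightarrow> a p q = 0"
    and cls: "\<And>i. i < s \<Longrightarrow> (\<forall>p\<in>N i. \<forall>k. pic k p = 0) \<or>
      (\<forall>p\<in>N i. \<forall>q\<in>N i. bdd_above (range (\<lambda>k. s_sum st (\<lambda>l. kpow st a (N i) l p q) {0..k})))"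
  shows "\<exists>M. \<forall>p\<in>S. \<forall>k. pic k p \<le> M"
proof -
  have "\<exists>M\<ge>0. \<forall>p\<in>(\<Union>j<i. N j). \<forall>k. pic k p \<le> M" if "i \<le> s" for i
    using that
  proof (induction i)
    case 0
    show ?case by auto
  next
    case (Suc i)
    define U where "U = (\<Union>j<i. N j)"
    obtain M where M0: "0 \<le> M" and M: "\<And>p k. p \<in> U \<Longrightarrow> pic k p \<le> M"
      using Suc by (auto simp: U_def)
    have U': "(\<Union>j<Suc i. N j) = U \<union> N i" by (auto simp: U_def lessThan_Suc)
    have US: "U \<subseteq> S" and NS: "N i \<subseteq> S" using Suc.prems S by (auto simp: U_def)
    note finU = finite_subset[OF US fin] finite_subset[OF NS fin]
    from cls[of i] Suc.prems consider "\<forall>p\<in>N i. \<forall>k. pic k p = 0"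
      | "\<forall>p\<in>N i. \<forall>q\<in>N i. bdd_above (range (\<lambda>k. s_sum st (\<lambda>l. kpow st a (N i) l p q) {0..k}))"
      by fastforce
    then show ?case
    proof cases
      case 1
      then show ?thesis unfolding U' using M M0 by (intro exI[of _ M]) auto
    next
      case 2
      \<comment> \<open>The bound M replaces all values on the earlier classes.\<close>
      define d where "d p = s_add st (s_sum st (\<lambda>q. a p q * M) U) (c p)" for p
      interpret T: nonneg_system st a "N i" d
      proof
        show "0 \<le> d p" if "p \<in> N i" for p
          unfolding d_def using that US NS M0 finU a_nonneg c_nonneg
          by (intro s_add_nonneg s_sum_nonneg mult_nonneg_nonneg) auto
      qed (use finU NS a_nonneg in auto)
      obtain M' where M': "0 \<le> M'" "\<And>k p. p \<in> N i \<Longrightarrow> T.pic k p \<le> M'"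
        using T.picard_bounded_if_star_bounded 2 by metis
      have "pic k p \<le> T.pic k p" if "p \<in> N i" for k p
        using that
      proof (induction k arbitrary: p)
        case (Suc k p)
        let ?f = "\<lambda>q. a p q * pic k q"
        have p: "p \<in> S" using Suc.prems NS by auto
        have f_nonneg: "0 \<le> ?f q" if "q \<in> S" for q
          using a_nonneg[OF p that] picard_nonneg[OF that] by simp
        have "s_sum st ?f (S - (U \<union> N i)) = 0"
        proof (intro s_sum_zero)
          fix q assume q: "q \<in> S - (U \<union> N i)"
          then obtain j where j: "j < s" "q \<in> N j" using S by auto
          then have "\<not> j < i" "j \<noteq> i" using q by (auto simp: U_def)
          then show "?f q = 0" using tri[of i j p q] j Suc.prems by simp
        qed (use fin in auto)
        moreover have "S = (U \<union> N i) \<union> (S - (U \<union> N i))" using US NS by auto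
        moreover have "s_sum st ?f ((U \<union> N i) \<union> (S - (U \<union> N i))) =
            s_add st (s_sum st ?f (U \<union> N i)) (s_sum st ?f (S - (U \<union> N i)))"
          using fin finU f_nonneg by (intro s_sum_Un) auto
        moreover have "0 \<le> s_sum st ?f (U \<union> N i)"
          using finU US NS f_nonneg by (intro s_sum_nonneg) auto
        ultimately have "s_sum st ?f S = s_sum st ?f (U \<union> N i)" by simp
        also have "\<dots> \<le> s_add st (s_sum st ?f U) (s_sum st ?f (N i))"
          using finU US NS f_nonneg by (intro s_sum_Un_le) auto
        also have "\<dots> \<le> s_add st (s_sum st (\<lambda>q. a p q * M) U) (s_sum st (\<lambda>q. a p q * T.pic k q) (N i))"
          using Suc US NS M finU a_nonneg p by (intro s_add_mono s_sum_mono mult_left_mono) auto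
        finally have "s_add st (s_sum st ?f S) (c p) \<le> s_add st (s_add st (s_sum st (\<lambda>q. a p q * M) U)
            (s_sum st (\<lambda>q. a p q * T.pic k q) (N i))) (c p)"
          by (rule s_add_mono) simp
        then show ?case by (simp only: picard.simps d_def[of p] s_add_ac)
      qed simp
      with M' have "pic k p \<le> M'" if "p \<in> N i" for k p
        using that by (meson order_trans)
      then show ?thesis unfolding U' using M M0 M'(1)
        by (intro exI[of _ "max M M'"]) (auto simp: le_max_iff_disj)
    qed
  qed
  then show ?thesis using S by blast
qed

end

section \<open>Matrices and their blocks\<close>

lemma zero_le_vec_iff: "v \<in> carrier_vec n \<Longrightarrow> 0\<^sub>v n \<le> v \<longleftrightarrow> (\<forall>i<n. 0 \<le> v $ i)"
  by (auto simp: less_eq_vec_def)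

lemma s_pow_mat_carrier:
  assumes "B \<in> carrier_mat d d"
  shows "s_pow_mat st B l \<in> carrier_mat d d"
  using assms by (induction l) (auto simp: s_mult_mat_def)

lemma s_pow_mat_index:
  assumes B: "B \<in> carrier_mat d d" and "i < d" "j < d"
  shows "s_pow_mat st B l $$ (i, j) = kpow st (\<lambda>i j. B $$ (i, j)) {0..<d} l i j"
  using assms(3)
proof (induction l arbitrary: j)
  case 0
  then show ?case using assms by simp
next
  case (Suc l)
  then show ?case using s_pow_mat_carrier[OF B, of st l] B assms(2)
    by (auto simp: s_mult_mat_def intro!: s_sum_cong)
qed

lemma star_vec_partial_index:
  assumes B: "B \<in> carrier_mat d d" and c: "c \<in> carrier_vec d"
    and B0: "0\<^sub>m d d \<le> B" and c0: "0\<^sub>v d \<le> c" and i: "i < d"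
  shows "star_vec_partial st B c k $ i = picard st (\<lambda>i j. B $$ (i, j)) {0..<d} (\<lambda>i. c $ i) k i"
proof -
  interpret nonneg_system st "\<lambda>i j. B $$ (i, j)" "{0..<d}" "\<lambda>i. c $ i"
    by standard (use B c B0 c0 in \<open>auto simp: less_eq_mat_def less_eq_vec_def\<close>)
  have "s_mult_mat_vec st (s_pow_mat st B l) c $ i = s_sum st (\<lambda>j. pw l i j * c $ j) {0..<d}" for l
    using s_pow_mat_carrier[OF B, of st l] B c i s_pow_mat_index[OF B i]
    by (auto simp: s_mult_mat_vec_def intro!: s_sum_cong)
  then show ?thesis using i c by (simp add: star_vec_partial_def picard_eq_sum)
qed

lemma star_converges_iff_kpow:
  assumes B: "B \<in> carrier_mat d d"
  shows "star_converges st B \<longleftrightarrow> (\<forall>i<d. \<forall>j<d.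
    bdd_above (range (\<lambda>k. s_sum st (\<lambda>l. kpow st (\<lambda>i j. B $$ (i, j)) {0..<d} l i j) {0..k})))"
  using B by (simp add: star_converges_def star_partial_def s_pow_mat_index)

lemma submatrix_interval:
  assumes A: "A \<in> carrier_mat n n" and "u' \<le> n" "v' \<le> n"
  shows "submatrix A {u..<u'} {v..<v'} \<in> carrier_mat (u' - u) (v' - v)"
    and "i < u' - u \<Longrightarrow> j < v' - v \<Longrightarrow> submatrix A {u..<u'} {v..<v'} $$ (i, j) = A $$ (u + i, v + j)"
proof -
  have "{i. i < n \<and> i \<in> {u..<u'}} = {u..<u'}" "{i. i < n \<and> i \<in> {v..<v'}} = {v..<v'}"
    using assms by auto
  with A show "submatrix A {u..<u'} {v..<v'} \<in> carrier_mat (u' - u) (v' - v)"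
    by (auto simp: submatrix_def simp del: atLeastLessThan_iff)
next
  assume ij: "i < u' - u" "j < v' - v"
  have "{a \<in> {u..<u'}. a < u + i} = {u..<u + i}" "{a \<in> {v..<v'}. a < v + j} = {v..<v + j}"
    using ij by auto
  then show "submatrix A {u..<u'} {v..<v'} $$ (i, j) = A $$ (u + i, v + j)"
    using submatrix_index_card[of "u + i" A "v + j" "{u..<u'}" "{v..<v'}"] A ij assms by simp
qed

lemma star_converges_block_iff_kpow:
  assumes A: "A \<in> carrier_mat n n" and uv: "u \<le> v" "v \<le> n"
  shows "star_converges st (mat_div (submatrix A {u..<v} {u..<v}) lam) \<longleftrightarrow>
    (\<forall>p\<in>{u..<v}. \<forall>q\<in>{u..<v}. bdd_above (range (\<lambda>k.
       s_sum st (\<lambda>l. kpow st (\<lambda>i j. A $$ (i, j) / lam) {u..<v} l p q) {0..k})))"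
proof -
  define B where "B = mat_div (submatrix A {u..<v} {u..<v}) lam"
  define d where "d = v - u"
  have img: "(+) u ` {0..<d} = {u..<v}" using uv by (simp add: d_def)
  have carr: "B \<in> carrier_mat d d"
    using submatrix_interval(1)[OF A uv(2) uv(2), of u u] by (simp add: B_def mat_div_def d_def)
  have B_index: "B $$ (i, j) = A $$ (u + i, u + j) / lam" if "i < d" "j < d" for i j
    using submatrix_interval(1)[OF A uv(2) uv(2), of u u] submatrix_interval(2)[OF A uv(2) uv(2), of i u j u] that
    by (simp add: B_def mat_div_def d_def)
  have kcong: "kpow st (\<lambda>i j. B $$ (i, j)) {0..<d} l i j = kpow st (\<lambda>i j. A $$ (i, j) / lam) {u..<v} l (u + i) (u + j)"
    if "i < d" "j < d" for l i j
  proof -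
    have "kpow st (\<lambda>i j. B $$ (i, j)) {0..<d} l i j = kpow st (\<lambda>i j. A $$ (u + i, u + j) / lam) {0..<d} l i j"
      using that(2) by (induction l arbitrary: j) (auto simp: B_index intro!: s_sum_cong)
    then show ?thesis
      using kpow_reindex[of "(+) u" "{0..<d}" i j st "\<lambda>i j. A $$ (i, j) / lam" l] that img by simp
  qed
  have ball: "(\<forall>p\<in>{u..<v}. P p) \<longleftrightarrow> (\<forall>i<d. P (u + i))" for P
    by (simp only: img[symmetric] ball_simps) auto
  show ?thesis unfolding B_def[symmetric] star_converges_iff_kpow[OF carr] ball
    by (simp add: kcong)
qed

section \<open>Convergence of a star and the maximum cycle mean\<close>

context nonneg_matrix
begin

lemma walk_prod_le_kpow:
  assumes "\<forall>l\<le>k. w l \<in> S"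
  shows "(\<Prod>l<k. a (w l) (w (Suc l))) \<le> pw k (w 0) (w k)"
  using assms
proof (induction k)
  case (Suc k)
  have "(\<Prod>l<Suc k. a (w l) (w (Suc l))) \<le> pw k (w 0) (w k) * a (w k) (w (Suc k))"
    using Suc a_nonneg by (auto intro: mult_right_mono)
  also have "\<dots> \<le> pw (Suc k) (w 0) (w (Suc k))"
    using Suc.prems kpow_nonneg a_nonneg
      s_sum_member_le[OF fin, of "w k" "\<lambda>q. pw k (w 0) q * a q (w (Suc k))" st] by auto
  finally show ?case .
qed simp

end

text \<open>
  A maximum, unlike a sum, is the weight of a single walk.  The alternative 0 covers the absence of
  walks, for instance the off-diagonal entries of the zeroth power.
\<close>

lemma kpow_MaxTimes_attained:
  assumes "finite S" "i \<in> S" "j \<in> S"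
  shows "kpow MaxTimes a S k i j = 0 \<or>
    (\<exists>w. w 0 = i \<and> w k = j \<and> (\<forall>l\<le>k. w l \<in> S) \<and>
      kpow MaxTimes a S k i j = (\<Prod>l<k. a (w l) (w (Suc l))))"
  using assms(3)
proof (induction k arbitrary: j)
  case 0
  then show ?case using assms by (auto intro: exI[of _ "\<lambda>_. i"])
next
  case (Suc k)
  let ?f = "\<lambda>q. kpow MaxTimes a S k i q * a q j"
  have "kpow MaxTimes a S (Suc k) i j \<in> insert 0 (?f ` S)"
    unfolding kpow.simps s_sum.simps using assms(1) by (intro Max_in) auto
  then consider "kpow MaxTimes a S (Suc k) i j = 0"
    | q where "q \<in> S" "kpow MaxTimes a S (Suc k) i j = ?f q" by auto
  then show ?case
  proof cases
    case (2 q)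
    from Suc.IH[OF 2(1)] show ?thesis
    proof
      assume "kpow MaxTimes a S k i q = 0"
      with 2 show ?thesis by simp
    next
      assume "\<exists>w. w 0 = i \<and> w k = q \<and> (\<forall>l\<le>k. w l \<in> S) \<and>
        kpow MaxTimes a S k i q = (\<Prod>l<k. a (w l) (w (Suc l)))"
      then obtain w where w: "w 0 = i" "w k = q" "\<forall>l\<le>k. w l \<in> S"
        "kpow MaxTimes a S k i q = (\<Prod>l<k. a (w l) (w (Suc l)))" by blast
      define w' where "w' = w(Suc k := j)"
      have "kpow MaxTimes a S (Suc k) i j = (\<Prod>l<Suc k. a (w' l) (w' (Suc l)))"
        using 2(2) w by (simp add: w'_def)
      moreover have "w' 0 = i" "w' (Suc k) = j" "\<forall>l\<le>Suc k. w' l \<in> S"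
        using w Suc.prems by (auto simp: w'_def le_Suc_eq)
      ultimately show ?thesis by blast
    qed
  qed blast
qed

text \<open>
  A walk with more than \<open>card S\<close> steps visits some node twice.  Deleting the closed part in between
  removes a factor that is at most 1, so the shorter walk weighs at least as much.
\<close>

lemma kpow_MaxTimes_cycle_removal:
  assumes S: "finite S" and a: "\<And>i j. i \<in> S \<Longrightarrow> j \<in> S \<Longrightarrow> 0 \<le> a i j"
    and cyc: "\<And>k w. 0 < k \<Longrightarrow> \<forall>l\<le>k. w l \<in> S \<Longrightarrow> w k = w 0 \<Longrightarrow> (\<Prod>l<k. a (w l) (w (Suc l))) \<le> 1"
    and "i \<in> S" "j \<in> S"
  shows "\<exists>l\<le>card S. kpow MaxTimes a S k i j \<le> kpow MaxTimes a S l i j"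
proof (induction k rule: less_induct)
  case (less k)
  interpret nonneg_matrix MaxTimes a S by standard (use S a in auto)
  show ?case
  proof (cases "k \<le> card S")
    case False
    from kpow_MaxTimes_attained[OF S assms(4,5), of a k] show ?thesis
    proof
      assume "pw k i j = 0"
      then show ?thesis using kpow_nonneg assms by (intro exI[of _ 0]) auto
    next
      assume "\<exists>w. w 0 = i \<and> w k = j \<and> (\<forall>l\<le>k. w l \<in> S) \<and> pw k i j = (\<Prod>l<k. a (w l) (w (Suc l)))"
      then obtain w where w: "w 0 = i" "w k = j" "\<forall>l\<le>k. w l \<in> S"
        and eq: "pw k i j = (\<Prod>l<k. a (w l) (w (Suc l)))" by blast
      have "\<not> inj_on w {..k}"
      proof
        assume "inj_on w {..k}"
        then have "card {..k} \<le> card S" using w(3) S by (intro card_inj_on_le) auto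
        with False show False by simp
      qed
      then obtain u v where uv: "u < v" "v \<le> k" "w u = w v"
        unfolding inj_on_def by (metis atMost_iff linorder_neqE_nat)
      define g where "g l = a (w l) (w (Suc l))" for l
      have g: "0 \<le> g l" if "l < k" for l
        using that w(3) by (auto simp: g_def intro!: a)
      have sp: "(\<Prod>l<k. g l) = (\<Prod>l<u. g l) * (\<Prod>l<v - u. g (u + l)) * (\<Prod>l<k - v. g (v + l))"
      proof -
        have "prod g {0..<k} = prod g {0..<u} * (prod g {u..<v} * prod g {v..<k})"
          using uv by (simp add: prod.atLeastLessThan_concat)
        moreover have "prod g {u..<v} = (\<Prod>l<v - u. g (u + l))"
          by (subst prod.atLeastLessThan_shift_0) (simp add: atLeast0LessThan)
        moreover have "prod g {v..<k} = (\<Prod>l<k - v. g (v + l))"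
          by (subst prod.atLeastLessThan_shift_0) (simp add: atLeast0LessThan)
        ultimately show ?thesis by (simp add: atLeast0LessThan mult.assoc)
      qed
      have 1: "(\<Prod>l<u. g l) \<le> pw u i (w u)"
        using walk_prod_le_kpow[of u w] w uv by (simp add: g_def)
      have 2: "(\<Prod>l<v - u. g (u + l)) \<le> 1"
        using cyc[of "v - u" "\<lambda>l. w (u + l)"] w uv by (simp add: g_def)
      have 3: "(\<Prod>l<k - v. g (v + l)) \<le> pw (k - v) (w u) j"
        using walk_prod_le_kpow[of "k - v" "\<lambda>l. w (v + l)"] w uv by (simp add: g_def)
      have nn: "0 \<le> (\<Prod>l<u. g l)" "0 \<le> (\<Prod>l<v - u. g (u + l))" "0 \<le> (\<Prod>l<k - v. g (v + l))"
        using uv g by (auto intro!: prod_nonneg)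
      have "(\<Prod>l<u. g l) * (\<Prod>l<v - u. g (u + l)) \<le> pw u i (w u) * 1"
        using 1 2 nn by (intro mult_mono) auto
      then have "pw k i j \<le> pw u i (w u) * pw (k - v) (w u) j"
        unfolding eq g_def[symmetric] sp using 1 3 nn
        by (intro mult_mono) auto
      also have "\<dots> \<le> pw (u + (k - v)) i j"
        using assms w uv by (intro kpow_mult_le) auto
      finally have "pw k i j \<le> pw (u + (k - v)) i j" .
      moreover have "u + (k - v) < k" using uv by simp
      ultimately show ?thesis using less.IH order_trans by blast
    qed
  qed blast
qed

text \<open>
  Running k times through a closed walk of weight P > 1 gives a power of P, which is unbounded.
  Otherwise the finitely many powers up to \<open>card S\<close> dominate all others.
\<close>

lemma kpow_MaxTimes_bounded_iff:
  assumes S: "finite S" and a: "\<And>i j. i \<in> S \<Longrightarrow> j \<in> S \<Longrightarrow> 0 \<le> a i j"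
  shows "(\<forall>i\<in>S. \<forall>j\<in>S. bdd_above (range (\<lambda>k. s_sum MaxTimes (\<lambda>l. kpow MaxTimes a S l i j) {0..k}))) \<longleftrightarrow>
    (\<forall>k w. 0 < k \<longrightarrow> (\<forall>l\<le>k. w l \<in> S) \<longrightarrow> w k = w 0 \<longrightarrow> (\<Prod>l<k. a (w l) (w (Suc l))) \<le> 1)"
    (is "?bdd \<longleftrightarrow> ?cyc")
proof
  interpret nonneg_matrix MaxTimes a S by standard (use S a in auto)
  assume bdd: ?bdd
  show ?cyc
  proof (intro allI impI, rule ccontr)
    fix L and w :: "nat \<Rightarrow> nat"
    assume w: "\<forall>l\<le>L. w l \<in> S" "w L = w 0" and "\<not> (\<Prod>l<L. a (w l) (w (Suc l))) \<le> 1"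
    then obtain P where P: "1 < P" "P = (\<Prod>l<L. a (w l) (w (Suc l)))" by simp
    have x: "w 0 \<in> S" using w by simp
    have "P ^ k \<le> pw (k * L) (w 0) (w 0)" for k
    proof (induction k)
      case (Suc k)
      have "P * P ^ k \<le> pw L (w 0) (w 0) * pw (k * L) (w 0) (w 0)"
        using Suc walk_prod_le_kpow[OF w(1)] w(2) P kpow_nonneg[OF x x] by (intro mult_mono) auto
      also have "\<dots> \<le> pw (L + k * L) (w 0) (w 0)" by (intro kpow_mult_le x)
      finally show ?case by simp
    qed simp
    moreover obtain M where M: "s_sum MaxTimes (\<lambda>l. pw l (w 0) (w 0)) {0..k} \<le> M" for k
      using bdd x unfolding bdd_above_def by blast
    moreover have "pw l (w 0) (w 0) \<le> s_sum MaxTimes (\<lambda>l. pw l (w 0) (w 0)) {0..l}" for l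
      using kpow_nonneg[OF x x] by (intro s_sum_member_le) auto
    ultimately have "P ^ k \<le> M" for k by (meson order_trans)
    moreover obtain k where "M < P ^ k" using real_arch_pow[OF P(1)] by blast
    ultimately show False by (meson not_le)
  qed
next
  interpret nonneg_matrix MaxTimes a S by standard (use S a in auto)
  assume cyc: ?cyc
  show ?bdd
  proof (intro ballI)
    fix i j assume ij: "i \<in> S" "j \<in> S"
    define M where "M = (\<Sum>l\<le>card S. pw l i j)"
    have M: "0 \<le> M" unfolding M_def using ij by (intro sum_nonneg kpow_nonneg)
    have "pw k i j \<le> M" for k
    proof -
      obtain l where l: "l \<le> card S" "pw k i j \<le> pw l i j"
        using kpow_MaxTimes_cycle_removal[of S a i j k] S a cyc ij by blast
      then show ?thesis unfolding M_def using ij kpow_nonneg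
        member_le_sum[of l "{..card S}" "\<lambda>l. pw l i j"] by fastforce
    qed
    with M show "bdd_above (range (\<lambda>k. s_sum MaxTimes (\<lambda>l. pw l i j) {0..k}))"
      by (auto simp: bdd_above_def intro!: exI[of _ M])
  qed
qed

text \<open>
  The supremum ranges over a nonempty bounded set, so it is compared with \<open>lam\<close> cycle by cycle.  A
  list of nodes, closed up by the index modulo its length, and a function w with w k = w 0 are two
  descriptions of the same closed walk.
\<close>

lemma perron_root_MaxTimes_le_iff:
  assumes B: "B \<in> carrier_mat d d" "0\<^sub>m d d \<le> B" and d: "0 < d" and lam: "0 \<le> lam"
  shows "perron_root MaxTimes B \<le> lam \<longleftrightarrow>
    (\<forall>k w. 0 < k \<longrightarrow> (\<forall>l\<le>k. w l \<in> {0..<d}) \<longrightarrow> w k = w 0 \<longrightarrow>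
      (\<Prod>l<k. B $$ (w l, w (Suc l))) \<le> lam ^ k)" (is "_ \<longleftrightarrow> ?cyc")
proof -
  define P where "P = {p. p \<noteq> [] \<and> set p \<subseteq> {0..<d}}"
  have Bnn: "0 \<le> B $$ (i, j)" if "i < d" "j < d" for i j
    using B that by (auto simp: less_eq_mat_def)
  have le: "cycle_mean B p \<le> mu \<longleftrightarrow> (\<Prod>l<length p. B $$ (p ! l, p ! (Suc l mod length p))) \<le> mu ^ length p"
    if "p \<noteq> []" "0 \<le> mu" for p mu
  proof -
    have "root (length p) (mu ^ length p) = mu" using that by (simp add: real_root_power_cancel)
    moreover have "0 < length p" using that by simp
    ultimately show ?thesis
      using real_root_le_iff[of "length p" "\<Prod>l<length p. B $$ (p ! l, p ! (Suc l mod length p))" "mu ^ length p"]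
      by (simp add: cycle_mean_def)
  qed
  have idx: "p ! (l mod length p) \<in> {0..<d}" if "p \<in> P" for p l
  proof -
    have "l mod length p < length p" using that by (simp add: P_def)
    then show ?thesis using that nth_mem unfolding P_def by blast
  qed
  have "bdd_above (cycle_mean B ` P)"
  proof -
    define M where "M = (\<Sum>i<d. \<Sum>j<d. B $$ (i, j))"
    have BM: "B $$ (i, j) \<le> M" if "i < d" "j < d" for i j
    proof -
      have "B $$ (i, j) \<le> (\<Sum>j<d. B $$ (i, j))"
        using that Bnn by (intro member_le_sum) auto
      also have "\<dots> \<le> M" unfolding M_def
        using that Bnn by (intro member_le_sum) (auto intro: sum_nonneg)
      finally show ?thesis .
    qed
    have M: "0 \<le> M" unfolding M_def using Bnn by (intro sum_nonneg) auto
    have "cycle_mean B p \<le> M" if p: "p \<in> P" for p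
    proof -
      have "(\<Prod>l<length p. B $$ (p ! l, p ! (Suc l mod length p))) \<le> (\<Prod>l<length p. M)"
      proof (intro prod_mono conjI)
        fix l assume "l \<in> {..<length p}"
        then have "p ! l \<in> {0..<d}" using idx[OF p, of l] by simp
        then show "0 \<le> B $$ (p ! l, p ! (Suc l mod length p))" "B $$ (p ! l, p ! (Suc l mod length p)) \<le> M"
          using Bnn BM idx[OF p, of "Suc l"] by auto
      qed
      then show ?thesis using le[of p M] p M by (simp add: P_def)
    qed
    then show ?thesis by (auto simp: bdd_above_def)
  qed
  moreover have "P \<noteq> {}" using d by (auto simp: P_def intro: exI[of _ "[0]"])
  moreover have "perron_root MaxTimes B = (SUP p\<in>P. cycle_mean B p)" using B by (simp add: P_def)
  ultimately have "perron_root MaxTimes B \<le> lam \<longleftrightarrow> (\<forall>p\<in>P. cycle_mean B p \<le> lam)"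
    by (simp add: cSUP_le_iff)
  also have "\<dots> \<longleftrightarrow> ?cyc"
  proof
    assume cm: "\<forall>p\<in>P. cycle_mean B p \<le> lam"
    show ?cyc
    proof (intro allI impI)
      fix k and w :: "nat \<Rightarrow> nat"
      assume w: "0 < k" "\<forall>l\<le>k. w l \<in> {0..<d}" "w k = w 0"
      define p where "p = map w [0..<k]"
      have p: "length p = k" "p \<noteq> []" "p \<in> P" using w by (auto simp: p_def P_def)
      have "B $$ (p ! l, p ! (Suc l mod k)) = B $$ (w l, w (Suc l))" if "l < k" for l
        using that w by (cases "Suc l = k") (auto simp: p_def)
      then have "(\<Prod>l<length p. B $$ (p ! l, p ! (Suc l mod length p))) = (\<Prod>l<k. B $$ (w l, w (Suc l)))"
        unfolding p(1) by (intro prod.cong) auto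
      then show "(\<Prod>l<k. B $$ (w l, w (Suc l))) \<le> lam ^ k"
        using cm le[OF p(2) lam] p by auto
    qed
  next
    assume cyc: ?cyc
    show "\<forall>p\<in>P. cycle_mean B p \<le> lam"
    proof
      fix p assume p: "p \<in> P"
      then have ne: "p \<noteq> []" by (simp add: P_def)
      have "(\<Prod>l<length p. B $$ (p ! (l mod length p), p ! (Suc l mod length p))) \<le> lam ^ length p"
        using cyc[rule_format, of "length p" "\<lambda>l. p ! (l mod length p)"] idx[OF p] ne by simp
      then show "cycle_mean B p \<le> lam" unfolding le[OF ne lam] by simp
    qed
  qed
  finally show ?thesis .
qed

lemma star_converges_MaxTimes_iff:
  assumes B: "B \<in> carrier_mat d d" "0\<^sub>m d d \<le> B" and d: "0 < d" and lam: "0 < lam"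
  shows "star_converges MaxTimes (mat_div B lam) \<longleftrightarrow> perron_root MaxTimes B \<le> lam"
proof -
  define a where "a i j = mat_div B lam $$ (i, j)" for i j
  have carr: "mat_div B lam \<in> carrier_mat d d" using B by (simp add: mat_div_def)
  have a: "a i j = B $$ (i, j) / lam" if "i < d" "j < d" for i j
    using that B by (simp add: a_def mat_div_def)
  have a_nn: "0 \<le> a i j" if "i \<in> {0..<d}" "j \<in> {0..<d}" for i j
    using that B lam by (auto simp: a less_eq_mat_def)
  have "star_converges MaxTimes (mat_div B lam) \<longleftrightarrow> (\<forall>i\<in>{0..<d}. \<forall>j\<in>{0..<d}.
      bdd_above (range (\<lambda>k. s_sum MaxTimes (\<lambda>l. kpow MaxTimes a {0..<d} l i j) {0..k})))"
    unfolding star_converges_iff_kpow[OF carr] a_def by (simp add: Ball_def)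
  also have "\<dots> \<longleftrightarrow> (\<forall>k w. 0 < k \<longrightarrow> (\<forall>l\<le>k. w l \<in> {0..<d}) \<longrightarrow> w k = w 0 \<longrightarrow>
      (\<Prod>l<k. a (w l) (w (Suc l))) \<le> 1)"
    using a_nn by (intro kpow_MaxTimes_bounded_iff) auto
  also have "\<dots> \<longleftrightarrow> (\<forall>k w. 0 < k \<longrightarrow> (\<forall>l\<le>k. w l \<in> {0..<d}) \<longrightarrow> w k = w 0 \<longrightarrow>
      (\<Prod>l<k. B $$ (w l, w (Suc l))) \<le> lam ^ k)"
  proof -
    have "(\<Prod>l<k. a (w l) (w (Suc l))) \<le> 1 \<longleftrightarrow> (\<Prod>l<k. B $$ (w l, w (Suc l))) \<le> lam ^ k"
      if "\<forall>l\<le>k. w l \<in> {0..<d}" for k w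
    proof -
      have "(\<Prod>l<k. a (w l) (w (Suc l))) = (\<Prod>l<k. B $$ (w l, w (Suc l)) / lam)"
        using that by (intro prod.cong) (auto simp: a)
      also have "\<dots> = (\<Prod>l<k. B $$ (w l, w (Suc l))) / lam ^ k" by (simp add: prod_dividef)
      finally show ?thesis using lam by (simp add: divide_le_eq_1)
    qed
    then show ?thesis by blast
  qed
  also have "\<dots> \<longleftrightarrow> perron_root MaxTimes B \<le> lam"
    using perron_root_MaxTimes_le_iff[OF B d, of lam] lam by simp
  finally show ?thesis .
qed

section \<open>Convergence of a star and the spectral radius\<close>

lemma smult_mat_mult_vec:
  fixes c :: "'a :: comm_semiring_0"
  assumes "A \<in> carrier_mat m n" "v \<in> carrier_vec n"
  shows "(c \<cdot>\<^sub>m A) *\<^sub>v v = c \<cdot>\<^sub>v (A *\<^sub>v v)"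
  using assms
  by (intro eq_vecI) (auto simp: scalar_prod_def sum_distrib_left mult.assoc intro!: sum.cong)

lemma mult_mat_vec_index_sum:
  assumes "A \<in> carrier_mat m n" "i < m" "v \<in> carrier_vec n"
  shows "(A *\<^sub>v v) $ i = (\<Sum>j = 0..<n. A $$ (i, j) * v $ j)"
  using assms by (auto simp: scalar_prod_def)

lemma pow_mat_complex_index:
  assumes B: "B \<in> carrier_mat d d" and "i < d" "j < d"
  shows "(map_mat complex_of_real B ^\<^sub>m k) $$ (i, j) =
    complex_of_real (kpow Nonneg (\<lambda>i j. B $$ (i, j)) {0..<d} k i j)"
proof -
  have "map_mat complex_of_real B ^\<^sub>m k = map_mat complex_of_real (B ^\<^sub>m k)"
    by (rule of_real_hom.mat_hom_pow[OF B, symmetric])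
  moreover have "(B ^\<^sub>m k) $$ (i, j) = kpow Nonneg (\<lambda>i j. B $$ (i, j)) {0..<d} k i j"
    using s_pow_mat_index[OF assms, of Nonneg k] by (simp add: s_pow_mat_Nonneg[OF B])
  moreover have "B ^\<^sub>m k \<in> carrier_mat d d" using B by simp
  ultimately show ?thesis using assms by simp
qed

text \<open>
  With the spectral radius below r and r < lam, the powers of B / r are bounded by the Jordan normal
  form, so the powers of B / lam are at most a constant times (r / lam)^k.
\<close>

lemma star_converges_if_spectral_radius_less:
  assumes B: "B \<in> carrier_mat d d" "0\<^sub>m d d \<le> B" and d: "0 < d" and lam: "0 < lam"
    and rho: "spectral_radius (map_mat complex_of_real B) < lam"
  shows "star_converges Nonneg (mat_div B lam)"
proof -
  let ?C = "map_mat complex_of_real B"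
  have C: "?C \<in> carrier_mat d d" using B by simp
  have rho0: "0 \<le> spectral_radius ?C"
    using spectral_radius_mem_max(1)[OF C d] by auto
  obtain r where r: "spectral_radius ?C < r" "r < lam" using rho dense by blast
  define D where "D = map_mat complex_of_real (mat_div B r)"
  have r0: "0 < r" using rho0 r by linarith
  have D: "D \<in> carrier_mat d d" using B by (simp add: D_def mat_div_def)
  have "spectral_radius D < 1"
  proof -
    obtain mu v where mu: "spectral_radius D = norm mu" and v: "v \<in> carrier_vec d" "v \<noteq> 0\<^sub>v d"
      "D *\<^sub>v v = mu \<cdot>\<^sub>v v"
      using spectral_radius_mem_max(1)[OF D d] D
      by (auto simp: spectrum_def eigenvalue_def eigenvector_def)
    have "?C = complex_of_real r \<cdot>\<^sub>m D"
      using B r0 by (intro eq_matI) (auto simp: D_def mat_div_def)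
    then have "?C *\<^sub>v v = complex_of_real r \<cdot>\<^sub>v (mu \<cdot>\<^sub>v v)"
      using D v by (simp add: smult_mat_mult_vec)
    then have "?C *\<^sub>v v = (complex_of_real r * mu) \<cdot>\<^sub>v v" by (simp add: smult_smult_assoc)
    then have "complex_of_real r * mu \<in> spectrum ?C"
      using v C by (auto simp: spectrum_def eigenvalue_def eigenvector_def)
    then have "norm (complex_of_real r * mu) \<le> spectral_radius ?C"
      using spectral_radius_mem_max(2)[OF C d] by blast
    then have "r * norm mu \<le> spectral_radius ?C" using r0 by (simp add: norm_mult)
    then have "r * norm mu < r * 1" using r(1) by linarith
    then show ?thesis using mu mult_less_cancel_left_pos[OF r0] by metis
  qed
  then obtain M where M: "norm_bound (D ^\<^sub>m k) M" for k
    using spectral_radius_jnf_norm_bound_less_1_upper_triangular[OF D] by blast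
  define g where "g = (\<lambda>i j. B $$ (i, j))"
  have cong: "kpow Nonneg (\<lambda>i j. mat_div B mu $$ (i, j)) {0..<d} k i j = (1 / mu) ^ k * kpow Nonneg g {0..<d} k i j"
    if "i < d" "j < d" "0 < mu" for i j k mu
  proof -
    have "kpow Nonneg (\<lambda>i j. mat_div B mu $$ (i, j)) {0..<d} k i j = kpow Nonneg (\<lambda>i j. (1 / mu) * g i j) {0..<d} k i j"
      using that(2) B that(1)
      by (induction k arbitrary: j) (auto simp: g_def mat_div_def)
    then show ?thesis using that by (simp only: kpow_scale finite_atLeastLessThan divide_nonneg_pos zero_le_one)
  qed
  have g_nn: "0 \<le> kpow Nonneg g {0..<d} k i j" if "i < d" "j < d" for i j k
  proof -
    interpret nonneg_matrix Nonneg g "{0..<d}"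
      by standard (use B in \<open>auto simp: g_def less_eq_mat_def\<close>)
    show ?thesis using kpow_nonneg that by simp
  qed
  have bound: "kpow Nonneg (\<lambda>i j. mat_div B lam $$ (i, j)) {0..<d} k i j \<le> M * (r / lam) ^ k"
    if ij: "i < d" "j < d" for i j k
  proof -
    have "norm ((D ^\<^sub>m k) $$ (i, j)) \<le> M"
      using M[of k] D ij by (simp add: norm_bound_def)
    moreover have "(D ^\<^sub>m k) $$ (i, j) = complex_of_real (kpow Nonneg (\<lambda>i j. mat_div B r $$ (i, j)) {0..<d} k i j)"
      unfolding D_def by (rule pow_mat_complex_index[OF _ ij]) (use B in \<open>simp add: mat_div_def\<close>)
    ultimately have "\<bar>(1 / r) ^ k * kpow Nonneg g {0..<d} k i j\<bar> \<le> M"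
      by (simp only: norm_of_real cong[OF ij r0])
    then have "(1 / r) ^ k * kpow Nonneg g {0..<d} k i j \<le> M" by linarith
    then have "(r / lam) ^ k * ((1 / r) ^ k * kpow Nonneg g {0..<d} k i j) \<le> (r / lam) ^ k * M"
      using r0 lam by (intro mult_left_mono) auto
    moreover have "(r / lam) ^ k * (1 / r) ^ k = (1 / lam) ^ k"
      using r0 by (simp add: power_mult_distrib[symmetric])
    ultimately show ?thesis by (simp only: cong[OF ij lam] mult.assoc[symmetric]) (simp only: mult.commute)
  qed
  have "summable (\<lambda>k. M * (r / lam) ^ k)"
    using r r0 by (intro summable_mult summable_geometric) auto
  then have sb: "(\<Sum>l\<in>{0..k}. M * (r / lam) ^ l) \<le> (\<Sum>l. M * (r / lam) ^ l)" for k
  proof (rule sum_le_suminf)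
    have "0 \<le> M"
      using bound[OF d d, of 0] by simp
    then show "0 \<le> M * (r / lam) ^ l" for l using r0 lam by simp
  qed simp
  have carr: "mat_div B lam \<in> carrier_mat d d" using B by (simp add: mat_div_def)
  show ?thesis unfolding star_converges_iff_kpow[OF carr]
  proof (intro allI impI)
    fix i j assume ij: "i < d" "j < d"
    show "bdd_above (range (\<lambda>k. s_sum Nonneg (\<lambda>l. kpow Nonneg (\<lambda>i j. mat_div B lam $$ (i, j)) {0..<d} l i j) {0..k}))"
      using order_trans[OF sum_mono[OF bound[OF ij]] sb]
      by (auto simp: bdd_above_def)
  qed
qed

text \<open>
  The terms of a convergent series tend to 0, hence (B / lam)^k v tends to 0 for every v.  For an
  eigenvector v whose eigenvalue has the spectral radius as modulus this forces that modulus to be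
  less than \<open>lam\<close>.
\<close>

lemma spectral_radius_less_if_star_converges:
  assumes B: "B \<in> carrier_mat d d" "0\<^sub>m d d \<le> B" and d: "0 < d" and lam: "0 < lam"
    and star: "star_converges Nonneg (mat_div B lam)"
  shows "spectral_radius (map_mat complex_of_real B) < lam"
proof (rule ccontr)
  let ?B = "mat_div B lam" and ?C = "map_mat complex_of_real (mat_div B lam)"
  let ?CB = "map_mat complex_of_real B"
  define f where "f k i j = kpow Nonneg (\<lambda>i j. ?B $$ (i, j)) {0..<d} k i j" for k i j
  assume not_less: "\<not> spectral_radius ?CB < lam"
  have carr: "?B \<in> carrier_mat d d" and C: "?C \<in> carrier_mat d d" and CB: "?CB \<in> carrier_mat d d"
    using B by (simp_all add: mat_div_def)
  interpret nonneg_matrix Nonneg "\<lambda>i j. ?B $$ (i, j)" "{0..<d}"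
    by standard (use B lam in \<open>auto simp: less_eq_mat_def mat_div_def\<close>)
  have lim: "(\<lambda>k. f k i j) \<longlonglongrightarrow> 0" if ij: "i < d" "j < d" for i j
  proof -
    have "bdd_above (range (\<lambda>k. \<Sum>l\<in>{0..k}. f l i j))"
      using star ij unfolding star_converges_iff_kpow[OF carr] f_def by simp
    then obtain M where "\<And>k. (\<Sum>l\<in>{0..k}. f l i j) \<le> M"
      by (auto simp: bdd_above_def)
    then have "summable (\<lambda>k. f k i j)"
      using ij kpow_nonneg by (intro bounded_imp_summable[of _ M]) (auto simp: f_def atLeast0AtMost)
    then show ?thesis by (rule summable_LIMSEQ_zero)
  qed
  obtain mu v where mu: "spectral_radius ?CB = norm mu" and v: "v \<in> carrier_vec d" "v \<noteq> 0\<^sub>v d"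
    "?CB *\<^sub>v v = mu \<cdot>\<^sub>v v"
    using spectral_radius_mem_max(1)[OF CB d] CB
    by (auto simp: spectrum_def eigenvalue_def eigenvector_def)
  \<comment> \<open>The eigenvalue of the scaled matrix that belongs to v.\<close>
  define nu where "nu = mu / complex_of_real lam"
  have "?C = (1 / complex_of_real lam) \<cdot>\<^sub>m ?CB"
    using B by (intro eq_matI) (auto simp: mat_div_def)
  then have "?C *\<^sub>v v = (1 / complex_of_real lam) \<cdot>\<^sub>v (mu \<cdot>\<^sub>v v)"
    using CB v by (simp add: smult_mat_mult_vec)
  then have "eigenvector ?C v nu"
    using v C by (simp add: eigenvector_def nu_def smult_smult_assoc)
  then have pow: "?C ^\<^sub>m k *\<^sub>v v = nu ^ k \<cdot>\<^sub>v v" for k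
    by (rule eigenvector_pow[OF C])
  obtain i where i: "i < d" "v $ i \<noteq> 0" using v by (metis carrier_vecD eq_vecI index_zero_vec)
  have eq: "(\<Sum>j = 0..<d. complex_of_real (f k i j) * v $ j) = nu ^ k * v $ i" for k
  proof -
    have W: "?C ^\<^sub>m k \<in> carrier_mat d d" by (rule pow_carrier_mat[OF C])
    have "(?C ^\<^sub>m k *\<^sub>v v) $ i = (\<Sum>j = 0..<d. (?C ^\<^sub>m k) $$ (i, j) * v $ j)"
      by (rule mult_mat_vec_index_sum[OF W i(1) v(1)])
    then have "(?C ^\<^sub>m k *\<^sub>v v) $ i = (\<Sum>j = 0..<d. complex_of_real (f k i j) * v $ j)"
      using i by (simp add: pow_mat_complex_index[OF carr] f_def)
    then show ?thesis using pow[of k] i v by simp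
  qed
  have "(\<lambda>k. \<Sum>j = 0..<d. complex_of_real (f k i j) * v $ j) \<longlonglongrightarrow> (\<Sum>j = 0..<d. complex_of_real 0 * v $ j)"
    using i by (intro tendsto_intros lim) auto
  then have "(\<lambda>k. nu ^ k * v $ i) \<longlonglongrightarrow> 0" by (simp add: eq)
  then have "(\<lambda>k. norm (nu ^ k * v $ i)) \<longlonglongrightarrow> 0" by (rule tendsto_norm_zero)
  moreover have "norm (v $ i) \<le> norm (nu ^ k * v $ i)" for k
  proof -
    have "1 \<le> norm nu" using not_less mu lam by (simp add: nu_def norm_divide)
    then have "1 * norm (v $ i) \<le> norm nu ^ k * norm (v $ i)"
      by (intro mult_right_mono one_le_power) auto
    then show ?thesis by (simp add: norm_mult norm_power)
  qed
  ultimately have "norm (v $ i) \<le> 0" by (meson LIMSEQ_le_const)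
  with i show False by simp
qed

lemma star_converges_iff_perron_root:
  assumes "B \<in> carrier_mat d d" "0\<^sub>m d d \<le> B" "0 < d" "0 < lam"
  shows "star_converges st (mat_div B lam) \<longleftrightarrow>
    (case st of MaxTimes \<Rightarrow> perron_root st B \<le> lam | Nonneg \<Rightarrow> perron_root st B < lam)"
  using assms star_converges_MaxTimes_iff[of B d lam] star_converges_if_spectral_radius_less[of B d lam]
    spectral_radius_less_if_star_converges[of B d lam]
  by (cases st) auto

section \<open>The system with a positive parameter\<close>

text \<open>
  Division by the positive number \<open>lam\<close> turns the system into a fixed-point equation, to which the
  preceding results on iterates apply.
\<close>

locale positive_parameter_system =
  fixes st :: setting and A :: "real mat" and b :: "real vec" and lam :: real and n :: nat
  assumes A: "A \<in> carrier_mat n n" and A_nonneg: "0\<^sub>m n n \<le> A"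
    and b: "b \<in> carrier_vec n" and b_nonneg: "0\<^sub>v n \<le> b"
    and lam: "0 < lam"
begin

sublocale nonneg_system st "\<lambda>i j. A $$ (i, j) / lam" "{0..<n}" "\<lambda>i. b $ i / lam"
  by standard (use A A_nonneg b b_nonneg lam in \<open>auto simp: less_eq_mat_def less_eq_vec_def\<close>)

abbreviation "x0 \<equiv> star_vec st (mat_div A lam) (vec_div b lam)"

abbreviation "converges \<equiv> star_vec_converges st (mat_div A lam) (vec_div b lam)"

lemma s_mult_mat_vec_scaled:
  assumes "x \<in> carrier_vec n" "i < n"
  shows "s_mult_mat_vec st A x $ i = lam * s_sum st (\<lambda>j. A $$ (i, j) / lam * x $ j) {0..<n}"
proof -
  have "s_mult_mat_vec st A x $ i = s_sum st (\<lambda>j. lam * (A $$ (i, j) / lam * x $ j)) {0..<n}"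
    using assms A lam by (auto simp: s_mult_mat_vec_def intro!: s_sum_cong)
  then show ?thesis using lam by (simp add: s_sum_distrib_left)
qed

lemma eigenvector_iff:
  assumes "v \<in> carrier_vec n"
  shows "s_mult_mat_vec st A v = lam \<cdot>\<^sub>v v \<longleftrightarrow>
    (\<forall>i<n. s_sum st (\<lambda>j. A $$ (i, j) / lam * v $ j) {0..<n} = v $ i)"
proof -
  have "s_mult_mat_vec st A v = lam \<cdot>\<^sub>v v \<longleftrightarrow> (\<forall>i<n. s_mult_mat_vec st A v $ i = lam * v $ i)"
    using assms A by (auto simp: vec_eq_iff s_mult_mat_vec_def)
  then show ?thesis using lam by (simp add: s_mult_mat_vec_scaled[OF assms])
qed

lemma is_solution_iff:
  "is_solution st A b lam x \<longleftrightarrow> x \<in> carrier_vec n \<and> (\<forall>i<n. 0 \<le> x $ i) \<and>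
    (\<forall>i<n. x $ i = s_add st (s_sum st (\<lambda>j. A $$ (i, j) / lam * x $ j) {0..<n}) (b $ i / lam))"
proof (cases "x \<in> carrier_vec n")
  case True
  have "lam \<cdot>\<^sub>v x = s_add_vec st (s_mult_mat_vec st A x) b \<longleftrightarrow>
      (\<forall>i<n. lam * x $ i = s_add st (s_mult_mat_vec st A x $ i) (b $ i))"
    using True b by (auto simp: vec_eq_iff s_add_vec_def)
  also have "\<dots> \<longleftrightarrow> (\<forall>i<n. lam * x $ i =
      lam * s_add st (s_sum st (\<lambda>j. A $$ (i, j) / lam * x $ j) {0..<n}) (b $ i / lam))"
    using lam True by (simp add: s_add_distrib_left s_mult_mat_vec_scaled)
  also have "\<dots> \<longleftrightarrow> (\<forall>i<n. x $ i =
      s_add st (s_sum st (\<lambda>j. A $$ (i, j) / lam * x $ j) {0..<n}) (b $ i / lam))"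
    using lam by simp
  finally show ?thesis using True b by (auto simp: is_solution_def less_eq_vec_def)
qed (use b in \<open>auto simp: is_solution_def\<close>)

text \<open>
  The entrywise equation has \<open>x\<close> on both sides and would loop as a rewrite rule, hence this
  form as separate facts.
\<close>

lemma is_solutionD:
  assumes "is_solution st A b lam x"
  shows "x \<in> carrier_vec n" and "i < n \<Longrightarrow> 0 \<le> x $ i"
    and "i < n \<Longrightarrow> x $ i = s_add st (s_sum st (\<lambda>j. A $$ (i, j) / lam * x $ j) {0..<n}) (b $ i / lam)"
  using assms unfolding is_solution_iff by blast+

lemma star_vec_partial_eq_picard: "i < n \<Longrightarrow>
  star_vec_partial st (mat_div A lam) (vec_div b lam) k $ i = pic k i"
proof -
  assume i: "i < n"
  have "star_vec_partial st (mat_div A lam) (vec_div b lam) k $ i =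
      picard st (\<lambda>i j. mat_div A lam $$ (i, j)) {0..<n} (\<lambda>i. vec_div b lam $ i) k i"
    using A A_nonneg b b_nonneg lam i
    by (intro star_vec_partial_index) (auto simp: mat_div_def vec_div_def less_eq_mat_def less_eq_vec_def)
  also have "\<dots> = pic k i"
    using i A b
  proof (induction k arbitrary: i)
    case (Suc k)
    then have "s_sum st (\<lambda>j. mat_div A lam $$ (i, j) * picard st (\<lambda>i j. mat_div A lam $$ (i, j)) {0..<n}
        (\<lambda>i. vec_div b lam $ i) k j) {0..<n} = s_sum st (\<lambda>j. A $$ (i, j) / lam * pic k j) {0..<n}"
      by (intro s_sum_cong) (auto simp: mat_div_def)
    then show ?case using Suc.prems by (simp add: vec_div_def)
  qed simp
  finally show ?thesis .
qed

lemma dim_vec_div: "dim_vec (vec_div b lam) = n"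
  using b by (simp add: vec_div_def)

lemma x0_index: "i < n \<Longrightarrow> x0 $ i = (SUP k\<in>{1..}. pic k i)"
  by (simp add: star_vec_def dim_vec_div star_vec_partial_eq_picard)

lemma x0_carrier: "x0 \<in> carrier_vec n"
  by (simp add: star_vec_def dim_vec_div)

lemma converges_iff: "converges \<longleftrightarrow> (\<forall>i<n. bdd_above (range (\<lambda>k. pic k i)))"
proof -
  have "converges \<longleftrightarrow> (\<forall>i<n. bdd_above ((\<lambda>k. pic k i) ` {1..}))"
    by (simp add: star_vec_converges_def dim_vec_div star_vec_partial_eq_picard)
  moreover have "bdd_above ((\<lambda>k. pic k i) ` {1..}) \<longleftrightarrow> bdd_above (range (\<lambda>k. pic k i))" for i
  proof -
    have nat_eq: "(UNIV :: nat set) = insert 0 {1..}" by auto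
    have "range (\<lambda>k. pic k i) = insert (pic 0 i) ((\<lambda>k. pic k i) ` {1..})"
      unfolding nat_eq by (rule image_insert)
    then show ?thesis by (simp only: bdd_above_insert)
  qed
  ultimately show ?thesis by simp
qed

lemma picard_tendsto_x0:
  assumes "converges" "i < n"
  shows "(\<lambda>k. pic k i) \<longlonglongrightarrow> x0 $ i"
  unfolding x0_index[OF assms(2)]
  by (rule picard_tendsto_SUP) (use assms converges_iff in \<open>auto intro: bdd_above_mono\<close>)

lemma picard_le_x0:
  assumes "converges" "i < n"
  shows "pic k i \<le> x0 $ i"
  using incseq_le[OF picard_incseq picard_tendsto_x0[OF assms]] assms(2) by simp

lemma x0_solution:
  assumes "converges"
  shows "is_solution st A b lam x0"
  unfolding is_solution_iff
proof (intro conjI allI impI x0_carrier)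
  fix i assume i: "i < n"
  show "0 \<le> x0 $ i" using picard_le_x0[OF assms i, of 0] by simp
  show "x0 $ i = s_add st (s_sum st (\<lambda>j. A $$ (i, j) / lam * x0 $ j) {0..<n}) (b $ i / lam)"
    using picard_tendsto_x0[OF assms] i by (intro picard_limit_fixpoint) auto
qed

lemma picard_le_solution:
  assumes "is_solution st A b lam x" "i < n"
  shows "pic k i \<le> x $ i"
proof (rule picard_le_supersolution)
  show "s_add st (s_sum st (\<lambda>j. A $$ (j', j) / lam * x $ j) {0..<n}) (b $ j' / lam) \<le> x $ j'"
    if "j' \<in> {0..<n}" for j'
    using is_solutionD(3)[OF assms(1), of j'] that by simp
qed (use is_solutionD(2)[OF assms(1)] assms(2) in auto)

lemma converges_if_solution:
  assumes "is_solution st A b lam x"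
  shows "converges"
  unfolding converges_iff bdd_above_def using picard_le_solution[OF assms] by blast

lemma x0_least_solution:
  assumes "converges"
  shows "is_least_solution st A b lam x0"
  unfolding is_least_solution_def
proof (intro conjI allI impI x0_solution[OF assms])
  fix y assume y: "is_solution st A b lam y"
  have "x0 $ i \<le> y $ i" if "i < n" for i
    using LIMSEQ_le_const2[OF picard_tendsto_x0[OF assms that]] picard_le_solution[OF y that] by blast
  then show "x0 \<le> y" using is_solutionD(1)[OF y] x0_carrier by (auto simp: less_eq_vec_def)
qed

lemma accesses_iff: "accesses A i j \<longleftrightarrow> (i, j) \<in> edges\<^sup>*"
proof -
  have "arcs A = edges" using A lam by (auto simp: arcs_def zero_less_divide_iff)
  then show ?thesis by (simp add: accesses_def)
qed

lemma supp_pos: "t \<in> supp b \<longleftrightarrow> t < n \<and> 0 < b $ t / lam"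
  using b b_nonneg lam by (auto simp: supp_def less_eq_vec_def zero_less_divide_iff order_less_le)

lemma picard_zero:
  assumes "i < n" "\<not> (\<exists>t\<in>supp b. accesses A i t)"
  shows "pic k i = 0"
proof (rule picard_zero_if_no_path)
  fix t assume "t \<in> {0..<n}" "(i, t) \<in> edges\<^sup>*"
  then have "\<not> 0 < b $ t / lam" using assms supp_pos accesses_iff by auto
  then show "b $ t / lam = 0" using c_nonneg[OF \<open>t \<in> {0..<n}\<close>] by linarith
qed (use assms in simp)

lemma x0_nonzero_iff:
  assumes "converges" "i < n"
  shows "x0 $ i \<noteq> 0 \<longleftrightarrow> (\<exists>t\<in>supp b. accesses A i t)"
proof
  assume "\<exists>t\<in>supp b. accesses A i t"
  then obtain t where "t \<in> supp b" "accesses A i t" by (elim bexE)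
  then have t: "(i, t) \<in> edges\<^sup>*" "0 < b $ t / lam"
    by (simp_all only: accesses_iff supp_pos)
  have "\<exists>k. 0 < pic k i"
    by (rule picard_pos_if_path[OF t(1) _ t(2)]) (use assms(2) in simp)
  then obtain k where "0 < pic k i" ..
  with picard_le_x0[OF assms, of k] show "x0 $ i \<noteq> 0" by simp
next
  assume nz: "x0 $ i \<noteq> 0"
  show "\<exists>t\<in>supp b. accesses A i t"
  proof (rule ccontr)
    assume "\<not> ?thesis"
    with assms(2) have "pic k i = 0" for k by (rule picard_zero)
    with nz show False using x0_index[OF assms(2)] by simp
  qed
qed

lemma solution_eq_x0_add:
  assumes "is_solution st A b lam x"
  shows "\<exists>v\<in>carrier_vec n. 0\<^sub>v n \<le> v \<and> s_mult_mat_vec st A v = lam \<cdot>\<^sub>v v \<and> x = s_add_vec st x0 v"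
proof -
  have conv: "converges" by (rule converges_if_solution[OF assms])
  show ?thesis
  proof (rule solution_decomposition[of "\<lambda>i. x0 $ i" "\<lambda>i. x $ i"])
    show "(\<lambda>k. pic k i) \<longlonglongrightarrow> x0 $ i" if "i \<in> {0..<n}" for i
      using picard_tendsto_x0[OF conv] that by simp
    show "0 \<le> x $ i" if "i \<in> {0..<n}" for i
      using is_solutionD(2)[OF assms] that by simp
    show "x $ i = s_add st (s_sum st (\<lambda>j. A $$ (i, j) / lam * x $ j) {0..<n}) (b $ i / lam)"
      if "i \<in> {0..<n}" for i
      by (rule is_solutionD(3)[OF assms]) (use that in simp)
    fix w
    assume w: "\<And>i. i \<in> {0..<n} \<Longrightarrow> 0 \<le> w i"
      "\<And>i. i \<in> {0..<n} \<Longrightarrow> s_sum st (\<lambda>j. A $$ (i, j) / lam * w j) {0..<n} = w i"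
      "\<And>i. i \<in> {0..<n} \<Longrightarrow> x $ i = s_add st (x0 $ i) (w i)"
    have v: "vec n w \<in> carrier_vec n" by simp
    have "s_sum st (\<lambda>j. A $$ (i, j) / lam * vec n w $ j) {0..<n} = vec n w $ i" if "i < n" for i
    proof -
      have "s_sum st (\<lambda>j. A $$ (i, j) / lam * vec n w $ j) {0..<n} =
          s_sum st (\<lambda>j. A $$ (i, j) / lam * w j) {0..<n}" by (intro s_sum_cong) auto
      then show ?thesis using w(2) that by simp
    qed
    then have "s_mult_mat_vec st A (vec n w) = lam \<cdot>\<^sub>v vec n w"
      unfolding eigenvector_iff[OF v] by blast
    moreover have "x = s_add_vec st x0 (vec n w)"
      using is_solutionD(1)[OF assms] w(3) by (intro eq_vecI) (auto simp: s_add_vec_def)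
    moreover have "0\<^sub>v n \<le> vec n w" using w(1) by (auto simp: less_eq_vec_def)
    ultimately show ?thesis using v by blast
  qed
qed

text \<open>
  In the max-times setting x0 + v equals x0 whenever v \<le> x0.  Therefore the eigenvector is first
  scaled so that its entry i becomes x0_i + 1.
\<close>

lemma unique_solution_iff:
  assumes conv: "converges"
  shows "(\<exists>!x. is_solution st A b lam x) \<longleftrightarrow> \<not> s_eigenvalue st A lam"
proof
  assume uniq: "\<exists>!x. is_solution st A b lam x"
  show "\<not> s_eigenvalue st A lam"
  proof
    assume "s_eigenvalue st A lam"
    then obtain v where v: "v \<in> carrier_vec n" "0\<^sub>v n \<le> v" "v \<noteq> 0\<^sub>v n"
      and ev: "s_mult_mat_vec st A v = lam \<cdot>\<^sub>v v"
      using A unfolding s_eigenvalue_def by auto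
    then obtain i where i: "i < n" "v $ i \<noteq> 0" by (auto simp: vec_eq_iff)
    moreover have "0 \<le> v $ i" using i(1) v(1,2) by (simp add: zero_le_vec_iff)
    ultimately have i: "i < n" "0 < v $ i" by simp_all
    \<comment> \<open>This factor gives r * v $ i = x0 $ i + 1, which no addition to x0 can absorb.\<close>
    define r where "r = (x0 $ i + 1) / v $ i"
    note sol = is_solutionD(2,3)[OF x0_solution[OF conv]]
    have r: "0 \<le> r" using i sol(1)[OF i(1)] by (simp add: r_def)
    have rv: "0 \<le> r * v $ j" if "j < n" for j
      using that r v(1,2) by (simp add: zero_le_vec_iff)
    define z where "z = vec n (\<lambda>j. s_add st (x0 $ j) (r * v $ j))"
    have "is_solution st A b lam z"
      unfolding is_solution_iff
    proof (intro conjI allI impI)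
      fix j assume j: "j < n"
      show "0 \<le> z $ j" using j sol(1) rv by (simp add: z_def s_add_nonneg)
      have ev_j: "s_sum st (\<lambda>q. A $$ (j, q) / lam * v $ q) {0..<n} = v $ j"
        using ev j unfolding eigenvector_iff[OF v(1)] by blast
      have "s_sum st (\<lambda>q. A $$ (j, q) / lam * z $ q) {0..<n} =
          s_sum st (\<lambda>q. s_add st (A $$ (j, q) / lam * x0 $ q) (r * (A $$ (j, q) / lam * v $ q))) {0..<n}"
      proof (rule s_sum_cong)
        fix q assume q: "q \<in> {0..<n}"
        then have "0 \<le> A $$ (j, q) / lam" using j by (intro a_nonneg) simp_all
        then have "A $$ (j, q) / lam * s_add st (x0 $ q) (r * v $ q) =
            s_add st (A $$ (j, q) / lam * x0 $ q) (A $$ (j, q) / lam * (r * v $ q))"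
          by (rule s_add_distrib_left)
        then show "A $$ (j, q) / lam * z $ q =
            s_add st (A $$ (j, q) / lam * x0 $ q) (r * (A $$ (j, q) / lam * v $ q))"
          using q by (simp add: z_def mult.left_commute)
      qed
      also have "\<dots> = s_add st (s_sum st (\<lambda>q. A $$ (j, q) / lam * x0 $ q) {0..<n}) (r * v $ j)"
        by (simp only: s_sum_s_add[OF fin] s_sum_distrib_left[OF fin r, symmetric] ev_j)
      finally have "s_add st (s_sum st (\<lambda>q. A $$ (j, q) / lam * z $ q) {0..<n}) (b $ j / lam) =
          s_add st (s_add st (s_sum st (\<lambda>q. A $$ (j, q) / lam * x0 $ q) {0..<n}) (b $ j / lam)) (r * v $ j)"
        by (simp only: s_add_ac)
      then show "z $ j = s_add st (s_sum st (\<lambda>q. A $$ (j, q) / lam * z $ q) {0..<n}) (b $ j / lam)"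
        using j by (simp only: sol(2)[OF j, symmetric] z_def index_vec)
    qed (simp add: z_def)
    then have "z = x0" using uniq x0_solution[OF conv] by blast
    moreover have "x0 $ i + 1 \<le> z $ i"
      using i s_add_upper(2)[OF sol(1)[OF i(1)], of "x0 $ i + 1" st] by (simp add: z_def r_def)
    ultimately show False by simp
  qed
next
  assume not_ev: "\<not> s_eigenvalue st A lam"
  show "\<exists>!x. is_solution st A b lam x"
  proof (rule ex1I[where a = x0])
    show "is_solution st A b lam x0" by (rule x0_solution[OF conv])
    fix x assume "is_solution st A b lam x"
    then obtain v where v: "v \<in> carrier_vec n" "0\<^sub>v n \<le> v" "s_mult_mat_vec st A v = lam \<cdot>\<^sub>v v"
      and x: "x = s_add_vec st x0 v" using solution_eq_x0_add by blast
    then have "v = 0\<^sub>v n" using not_ev A by (auto simp: s_eigenvalue_def)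
    then show "x = x0"
      using x x0_carrier is_solutionD(2)[OF x0_solution[OF conv]]
      by (intro eq_vecI) (auto simp: s_add_vec_def)
  qed
qed

end

section \<open>The classes of a Frobenius normal form\<close>

text \<open>
  The normal form in terms of the entries of A instead of its submatrices.  A class with one node
  is irreducible whatever its entry is; there access is trivial, as a node accesses itself.
\<close>

lemma frobenius_normal_form_classes:
  assumes A: "A \<in> carrier_mat n n" and fnf: "frobenius_normal_form A s N"
  obtains m where "\<And>j. j < s \<Longrightarrow> N j = {m j..<m (Suc j)}" "\<And>j. j < s \<Longrightarrow> m j < m (Suc j)"
    "\<And>j. j < s \<Longrightarrow> m (Suc j) \<le> n"
    "{0..<n} = (\<Union>j<s. N j)"
    "\<And>i j p q. i < j \<Longrightarrow> j < s \<Longrightarrow> p \<in> N i \<Longrightarrow> q \<in> N j \<Longrightarrow> A $$ (p, q) = 0"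
    "\<And>j p q. j < s \<Longrightarrow> p \<in> N j \<Longrightarrow> q \<in> N j \<Longrightarrow> accesses A p q"
proof -
  obtain m where m0: "m 0 = 0" and ms: "m s = n"
    and m: "\<And>j. j < s \<Longrightarrow> m j < m (Suc j)" and N: "\<And>j. j < s \<Longrightarrow> N j = {m j..<m (Suc j)}"
    using fnf A by (auto simp: frobenius_normal_form_def)
  have zero: "submatrix A (N i) (N j) = 0\<^sub>m (card (N i)) (card (N j))" if "i < j" "j < s" for i j
    using fnf that by (auto simp: frobenius_normal_form_def)
  have irr: "irreducible_mat (submatrix A (N j) (N j))" if "j < s" for j
    using fnf that by (auto simp: frobenius_normal_form_def)
  have m_le: "m j \<le> m k" if "j \<le> k" "k \<le> s" for j k
    using that
  proof (induction k rule: dec_induct)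
    case (step k)
    then show ?case using m[of k] by simp
  qed simp
  then have le_n: "m (Suc j) \<le> n" if "j < s" for j
    using that ms by (metis Suc_leI order_refl)
  have "{0..<m k} = (\<Union>j<k. N j)" if "k \<le> s" for k
    using that
  proof (induction k)
    case (Suc k)
    have "{0..<m (Suc k)} = {0..<m k} \<union> N k" using Suc.prems m[of k] N[of k] by auto
    also have "{0..<m k} = (\<Union>j<k. N j)" using Suc by simp
    finally show ?case by (simp only: lessThan_Suc UN_insert Un_commute)
  qed (simp add: m0)
  from this[of s] have cover: "{0..<n} = (\<Union>j<s. N j)" by (simp add: ms)
  have tri: "A $$ (p, q) = 0" if "i < j" "j < s" "p \<in> N i" "q \<in> N j" for i j p q
  proof -
    have "A $$ (p, q) = submatrix A (N i) (N j) $$ (p - m i, q - m j)"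
      using that N[of i] N[of j] submatrix_interval(2)[OF A le_n[of i] le_n[of j], of "p - m i" "m i" "q - m j" "m j"]
      by auto
    also have "\<dots> = 0"
      unfolding zero[OF that(1,2)] using that N[of i] N[of j] by auto
    finally show ?thesis .
  qed
  have acc: "accesses A p q" if "j < s" "p \<in> N j" "q \<in> N j" for j p q
  proof -
    define B where "B = submatrix A (N j) (N j)"
    have B: "B \<in> carrier_mat (m (Suc j) - m j) (m (Suc j) - m j)"
      and B_index: "\<And>u v. u < m (Suc j) - m j \<Longrightarrow> v < m (Suc j) - m j \<Longrightarrow> B $$ (u, v) = A $$ (m j + u, m j + v)"
      using submatrix_interval[OF A le_n[OF that(1)] le_n[OF that(1)]] N[OF that(1)] by (auto simp: B_def)
    have pq: "m j \<le> p" "p - m j < dim_row B" "m j \<le> q" "q - m j < dim_row B"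
      using that N[OF that(1)] B by auto
    show ?thesis
    proof (cases "dim_row B = 1")
      case True
      with pq have "p = q" by simp
      then show ?thesis by (simp add: accesses_def)
    next
      case False
      then have "(p - m j, q - m j) \<in> (arcs B)\<^sup>*"
        using irr[OF that(1)] pq by (auto simp: irreducible_mat_def B_def[symmetric] accesses_def)
      then have "(m j + (p - m j), m j + (q - m j)) \<in> (arcs A)\<^sup>*"
      proof (induction rule: rtrancl_induct)
        case (step y z)
        then have "(m j + y, m j + z) \<in> arcs A"
          using B B_index A le_n[OF that(1)] by (auto simp: arcs_def)
        with step show ?case by auto
      qed simp
      then show ?thesis using pq by (simp add: accesses_def)
    qed
  qed
  show thesis by (rule that[OF N m le_n cover tri acc])
qed

lemma frobenius_class_subset:
  assumes "A \<in> carrier_mat n n" "frobenius_normal_form A s N" "i < s"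
  shows "N i \<subseteq> {0..<n}"
proof -
  have "{0..<n} = (\<Union>j<s. N j)"
    using frobenius_normal_form_classes[OF assms(1,2)] by blast
  with assms(3) show ?thesis by blast
qed

lemma converges_iff_class_stars:
  assumes sys: "positive_parameter_system A b lam n" and fnf: "frobenius_normal_form A s N"
  shows "star_vec_converges st (mat_div A lam) (vec_div b lam) \<longleftrightarrow>
    (\<forall>j\<in>accessing_classes A b s N. star_converges st (mat_div (submatrix A (N j) (N j)) lam))"
    (is "_ \<longleftrightarrow> ?stars")
proof -
  interpret positive_parameter_system st A b lam n by (rule sys)
  obtain m where N: "\<And>j. j < s \<Longrightarrow> N j = {m j..<m (Suc j)}" and m: "\<And>j. j < s \<Longrightarrow> m j < m (Suc j)"
    and le_n: "\<And>j. j < s \<Longrightarrow> m (Suc j) \<le> n" and cover: "{0..<n} = (\<Union>j<s. N j)"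
    and tri: "\<And>i j p q. i < j \<Longrightarrow> j < s \<Longrightarrow> p \<in> N i \<Longrightarrow> q \<in> N j \<Longrightarrow> A $$ (p, q) = 0"
    and acc: "\<And>j p q. j < s \<Longrightarrow> p \<in> N j \<Longrightarrow> q \<in> N j \<Longrightarrow> accesses A p q"
    using frobenius_normal_form_classes[OF A fnf] by blast
  have star: "star_converges st (mat_div (submatrix A (N j) (N j)) lam) \<longleftrightarrow>
    (\<forall>p\<in>N j. \<forall>q\<in>N j. bdd_above (range (\<lambda>k.
       s_sum st (\<lambda>l. kpow st (\<lambda>i j. A $$ (i, j) / lam) (N j) l p q) {0..k})))" if "j < s" for j
    using star_converges_block_iff_kpow[OF A less_imp_le[OF m[OF that]] le_n[OF that], of st lam]
    by (simp only: N[OF that])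
  show ?thesis
  proof
    assume conv: "converges"
    show ?stars
    proof
      fix j assume "j \<in> accessing_classes A b s N"
      then obtain r' t where j: "j < s" and r': "r' \<in> N j" "t \<in> supp b" "accesses A r' t"
        by (auto simp: accessing_classes_def set_accesses_def)
      have sub: "N j \<subseteq> {0..<n}" using cover j by auto
      show "star_converges st (mat_div (submatrix A (N j) (N j)) lam)"
        unfolding star[OF j]
      proof (intro ballI)
        fix p r assume pr: "p \<in> N j" "r \<in> N j"
        have "accesses A r t" using acc[OF j pr(2) r'(1)] r'(3) by (auto simp: accesses_def)
        then show "bdd_above (range (\<lambda>k.
            s_sum st (\<lambda>l. kpow st (\<lambda>i j. A $$ (i, j) / lam) (N j) l p r) {0..k}))"
          using conv converges_iff sub pr r'(2) supp_pos
          by (intro class_star_bounded[of "N j" p r t]) (auto simp: accesses_iff)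
      qed
    qed
  next
    assume stars: ?stars
    have "\<exists>M. \<forall>p\<in>{0..<n}. \<forall>k. pic k p \<le> M"
    proof (rule picard_bounded_blockwise[where s = s and N = N])
      show "{0..<n} = (\<Union>j<s. N j)" by (rule cover)
      show "A $$ (p, q) / lam = 0" if "i < j" "j < s" "p \<in> N i" "q \<in> N j" for i j p q
        using tri[OF that] by simp
      fix i assume i: "i < s"
      show "(\<forall>p\<in>N i. \<forall>k. pic k p = 0) \<or> (\<forall>p\<in>N i. \<forall>q\<in>N i. bdd_above (range (\<lambda>k.
          s_sum st (\<lambda>l. kpow st (\<lambda>i j. A $$ (i, j) / lam) (N i) l p q) {0..k})))"
      proof (cases "i \<in> accessing_classes A b s N")
        case True
        with stars show ?thesis by (intro disjI2) (simp only: star[OF i, symmetric])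
      next
        case False
        have "pic k p = 0" if "p \<in> N i" for p k
        proof (rule picard_zero)
          have "p \<in> (\<Union>j<s. N j)" using that i by blast
          then show "p < n" unfolding cover[symmetric] by simp
          show "\<not> (\<exists>t\<in>supp b. accesses A p t)"
            using False that i by (auto simp: accessing_classes_def set_accesses_def)
        qed
        then show ?thesis by (intro disjI1 ballI allI)
      qed
    qed
    then obtain M where M: "\<forall>p\<in>{0..<n}. \<forall>k. pic k p \<le> M" ..
    show converges
      unfolding converges_iff
    proof (intro allI impI)
      fix i assume "i < n"
      then have "pic k i \<le> M" for k using M by simp
      then show "bdd_above (range (\<lambda>k. pic k i))" by (rule bdd_aboveI2)
    qed
  qed
qed

lemma class_stars_iff_max_perron_root:
  assumes A: "A \<in> carrier_mat n n" "0\<^sub>m n n \<le> A" and fnf: "frobenius_normal_form A s N"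
    and J: "J \<subseteq> {..<s}" and lam: "0 < lam"
  shows "(\<forall>j\<in>J. star_converges st (mat_div (submatrix A (N j) (N j)) lam)) \<longleftrightarrow>
    (case st of MaxTimes \<Rightarrow> max_perron_root st A N J \<le> lam | Nonneg \<Rightarrow> max_perron_root st A N J < lam)"
proof -
  obtain m where N: "\<And>j. j < s \<Longrightarrow> N j = {m j..<m (Suc j)}" and m: "\<And>j. j < s \<Longrightarrow> m j < m (Suc j)"
    and le_n: "\<And>j. j < s \<Longrightarrow> m (Suc j) \<le> n"
    using frobenius_normal_form_classes[OF A(1) fnf] by metis
  have "star_converges st (mat_div (submatrix A (N j) (N j)) lam) \<longleftrightarrow>
      (case st of MaxTimes \<Rightarrow> perron_root st (submatrix A (N j) (N j)) \<le> lam
       | Nonneg \<Rightarrow> perron_root st (submatrix A (N j) (N j)) < lam)" if "j \<in> J" for j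
  proof (rule star_converges_iff_perron_root)
    have j: "j < s" using that J by auto
    show "submatrix A (N j) (N j) \<in> carrier_mat (m (Suc j) - m j) (m (Suc j) - m j)"
      unfolding N[OF j] by (rule submatrix_interval(1)[OF A(1) le_n[OF j] le_n[OF j]])
    then show "0\<^sub>m (m (Suc j) - m j) (m (Suc j) - m j) \<le> submatrix A (N j) (N j)"
      using submatrix_interval(2)[OF A(1) le_n[OF j] le_n[OF j]] A le_n[OF j]
      by (auto simp: N[OF j] less_eq_mat_def)
    show "0 < m (Suc j) - m j" using m[OF j] by simp
  qed (rule lam)
  moreover have "finite J" using J finite_subset by blast
  ultimately show ?thesis using lam
    by (cases "J = {}"; cases st) (simp_all add: max_perron_root_def)
qed

section \<open>The parameter zero\<close>

text \<open>
  Division by 0 gives 0, so every term of the series vanishes.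
\<close>

lemma star_vec_div_zero:
  assumes "A \<in> carrier_mat n n" "b \<in> carrier_vec n"
  shows "star_vec st (mat_div A 0) (vec_div b 0) = 0\<^sub>v n"
proof (intro eq_vecI)
  fix i assume "i < dim_vec (0\<^sub>v n)"
  then have i: "i < n" by simp
  have "star_vec_partial st (mat_div A 0) (vec_div b 0) k $ i = 0" for k
  proof -
    have "star_vec_partial st (mat_div A 0) (vec_div b 0) k $ i =
        picard st (\<lambda>i j. mat_div A 0 $$ (i, j)) {0..<n} (\<lambda>i. vec_div b 0 $ i) k i"
      using assms i
      by (intro star_vec_partial_index) (auto simp: mat_div_def vec_div_def less_eq_mat_def less_eq_vec_def)
    also have "\<dots> = 0"
    proof -
      interpret nonneg_system st "\<lambda>i j. mat_div A 0 $$ (i, j)" "{0..<n}" "\<lambda>i. vec_div b 0 $ i"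
        by standard (use assms in \<open>auto simp: mat_div_def vec_div_def\<close>)
      show ?thesis
        by (rule picard_zero_if_no_path) (use assms i in \<open>auto simp: vec_div_def\<close>)
    qed
    finally show ?thesis .
  qed
  then show "star_vec st (mat_div A 0) (vec_div b 0) $ i = 0\<^sub>v n $ i"
    using i assms by (simp add: star_vec_def) (simp add: vec_div_def)
qed (use assms in \<open>simp add: star_vec_def vec_div_def\<close>)

text \<open>
  In both settings a sum of two nonnegative numbers vanishes only if both do.
\<close>

lemma is_solution_zero_iff:
  assumes A: "A \<in> carrier_mat n n" "0\<^sub>m n n \<le> A" and b: "b \<in> carrier_vec n" "0\<^sub>v n \<le> b"
  shows "is_solution st A b 0 x \<longleftrightarrow>
    b = 0\<^sub>v n \<and> x \<in> carrier_vec n \<and> 0\<^sub>v n \<le> x \<and> s_mult_mat_vec st A x = 0 \<cdot>\<^sub>v x"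
proof (cases "x \<in> carrier_vec n \<and> 0\<^sub>v n \<le> x")
  case True
  define y where "y = s_mult_mat_vec st A x"
  have x: "x \<in> carrier_vec n" and x_nonneg: "\<And>i. i < n \<Longrightarrow> 0 \<le> x $ i"
    using True zero_le_vec_iff[of x n] by auto
  have y: "y \<in> carrier_vec n" using A(1) by (simp add: y_def s_mult_mat_vec_def)
  have "0 \<le> A $$ (i, j) * x $ j" if "i < n" "j < n" for i j
    using that A x_nonneg by (intro mult_nonneg_nonneg) (auto simp: less_eq_mat_def)
  then have y_nonneg: "0 \<le> y $ i" if "i < n" for i
    using that x A(1) by (auto simp: y_def s_mult_mat_vec_def intro!: s_sum_nonneg)
  have b_nonneg: "0 \<le> b $ i" if "i < n" for i using b that by (simp add: zero_le_vec_iff)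
  have "s_add st y z = 0 \<longleftrightarrow> y = 0 \<and> z = 0" if "0 \<le> y" "0 \<le> z" for y z
    using that by (cases st) (auto simp: max_def)
  then have add0: "s_add st (y $ i) (b $ i) = 0 \<longleftrightarrow> y $ i = 0 \<and> b $ i = 0" if "i < n" for i
    using y_nonneg b_nonneg that by blast
  have "0 \<cdot>\<^sub>v x = s_add_vec st y b \<longleftrightarrow> (\<forall>i<n. s_add st (y $ i) (b $ i) = 0)"
    using x y b(1) by (auto simp: vec_eq_iff s_add_vec_def)
  also have "\<dots> \<longleftrightarrow> (\<forall>i<n. y $ i = 0) \<and> (\<forall>i<n. b $ i = 0)"
    using add0 by blast
  also have "(\<forall>i<n. y $ i = 0) \<longleftrightarrow> y = 0 \<cdot>\<^sub>v x"
    using x y by (auto simp: vec_eq_iff)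
  also have "(\<forall>i<n. b $ i = 0) \<longleftrightarrow> b = 0\<^sub>v n"
    using b(1) by (auto simp: vec_eq_iff)
  finally show ?thesis using True b(1) by (auto simp: is_solution_def y_def)
qed (use b in \<open>auto simp: is_solution_def\<close>)

lemma s_mult_mat_vec_zero:
  assumes "A \<in> carrier_mat n n"
  shows "s_mult_mat_vec st A (0\<^sub>v n) = 0\<^sub>v n"
  using assms by (intro eq_vecI) (auto simp: s_mult_mat_vec_def intro!: s_sum_zero)

section \<open>Solvability of the system\<close>

theorem theorem3p8:
  fixes st :: setting and A :: "real mat" and b :: "real vec" and lam :: real
    and n s :: nat and N :: "nat \<Rightarrow> nat set"
  assumes "A \<in> carrier_mat n n" and "0\<^sub>m n n \<le> A"
    and "frobenius_normal_form A s N"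
    and "b \<in> carrier_vec n" and "0\<^sub>v n \<le> b"
    and "0 \<le> lam"
  shows "let J = accessing_classes A b s N;
             rhobar = max_perron_root st A N J;
             x0 = star_vec st (mat_div A lam) (vec_div b lam);
             cond_i = (\<exists>x. is_solution st A b lam x);
             cond_ii = (\<exists>x. is_least_solution st A b lam x);
             cond_iii = star_vec_converges st (mat_div A lam) (vec_div b lam);
             cond_iv = (\<forall>j\<in>J. star_converges st (mat_div (submatrix A (N j) (N j)) lam));
             cond_v = (case st of MaxTimes \<Rightarrow> rhobar \<le> lam | Nonneg \<Rightarrow> rhobar < lam)
         in (cond_i \<longleftrightarrow> cond_ii) \<and>
            (0 < lam \<longrightarrow> (cond_i \<longleftrightarrow> cond_iii) \<and> (cond_i \<longleftrightarrow> cond_iv) \<and> (cond_i \<longleftrightarrow> cond_v)) \<and>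
            (cond_i \<longrightarrow>
               is_least_solution st A b lam x0 \<and>
               (\<forall>i<s. (i \<in> J \<longrightarrow> (\<exists>p \<in> N i. x0 $ p \<noteq> 0)) \<and> (i \<notin> J \<longrightarrow> (\<forall>p \<in> N i. x0 $ p = 0))) \<and>
               ((\<exists>!x. is_solution st A b lam x) \<longleftrightarrow> \<not> s_eigenvalue st A lam) \<and>
               (\<forall>x. is_solution st A b lam x \<longrightarrow>
                  (\<exists>v \<in> carrier_vec n. 0\<^sub>v n \<le> v \<and> s_mult_mat_vec st A v = lam \<cdot>\<^sub>v v \<and>
                     x = s_add_vec st x0 v)))"
proof (cases "lam = 0")
  case True
  define J where "J = accessing_classes A b s N"
  have sol: "is_solution st A b 0 x \<longleftrightarrow>
      b = 0\<^sub>v n \<and> x \<in> carrier_vec n \<and> 0\<^sub>v n \<le> x \<and> s_mult_mat_vec st A x = 0 \<cdot>\<^sub>v x" for x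
    by (rule is_solution_zero_iff[OF assms(1,2,4,5)])
  have least: "is_least_solution st A b 0 (0\<^sub>v n)" if "is_solution st A b 0 x" for x
    using that s_mult_mat_vec_zero[OF assms(1)] unfolding is_least_solution_def sol by auto
  have J_empty: "J = {}" if "is_solution st A b 0 x" for x
    using that unfolding sol J_def by (auto simp: accessing_classes_def set_accesses_def supp_def)
  have uniq: "(\<exists>!x. is_solution st A b 0 x) \<longleftrightarrow> \<not> s_eigenvalue st A 0"
    if "is_solution st A b 0 y" for y
  proof -
    have "is_solution st A b 0 (0\<^sub>v n)" using least[OF that] by (simp add: is_least_solution_def)
    then have "(\<exists>!x. is_solution st A b 0 x) \<longleftrightarrow> (\<forall>x. is_solution st A b 0 x \<longrightarrow> x = 0\<^sub>v n)" by blast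
    also have "\<dots> \<longleftrightarrow> \<not> s_eigenvalue st A 0"
      using that assms(1) unfolding sol s_eigenvalue_def carrier_matD(1)[OF assms(1)] by blast
    finally show ?thesis .
  qed
  have add_zero: "x = s_add_vec st (0\<^sub>v n) x" if "is_solution st A b 0 x" for x
  proof (rule eq_vecI)
    have x: "x \<in> carrier_vec n" "0\<^sub>v n \<le> x" using that by (simp_all add: sol)
    fix i assume "i < dim_vec (s_add_vec st (0\<^sub>v n) x)"
    then have i: "i < n" using x(1) by (simp add: s_add_vec_def)
    then have "0 \<le> x $ i" using x zero_le_vec_iff by blast
    then show "x $ i = s_add_vec st (0\<^sub>v n) x $ i" using i x(1) by (simp add: s_add_vec_def)
  qed (simp add: s_add_vec_def)
  have zero_entries: "0\<^sub>v n $ p = (0 :: real)" if "i < s" "p \<in> N i" for i p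
    using frobenius_class_subset[OF assms(1,3) that(1)] that(2) by auto
  show ?thesis
    unfolding True Let_def star_vec_div_zero[OF assms(1,4)] J_def[symmetric]
  proof (intro conjI impI allI)
    show "(\<exists>x. is_solution st A b 0 x) = (\<exists>x. is_least_solution st A b 0 x)"
      using least unfolding is_least_solution_def by blast
  next
    assume "\<exists>x. is_solution st A b 0 x"
    then obtain y where y: "is_solution st A b 0 y" ..
    show "is_least_solution st A b 0 (0\<^sub>v n)" by (rule least[OF y])
    show "(\<exists>!x. is_solution st A b 0 x) = (\<not> s_eigenvalue st A 0)" by (rule uniq[OF y])
    fix i assume "i < s"
    show "\<exists>p\<in>N i. 0\<^sub>v n $ p \<noteq> (0::real)" if "i \<in> J" using that J_empty[OF y] by simp
    show "\<forall>p\<in>N i. 0\<^sub>v n $ p = (0::real)" using zero_entries \<open>i < s\<close> by blast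
  next
    fix x assume "is_solution st A b 0 x"
    then show "\<exists>v\<in>carrier_vec n. 0\<^sub>v n \<le> v \<and> s_mult_mat_vec st A v = 0 \<cdot>\<^sub>v v \<and> x = s_add_vec st (0\<^sub>v n) v"
      using sol add_zero by blast
  qed simp_all
next
  case False
  with assms(6) have lam: "0 < lam" by simp
  have sys: "positive_parameter_system A b lam n"
    using assms lam by unfold_locales
  interpret positive_parameter_system st A b lam n by (rule sys)
  define J where "J = accessing_classes A b s N"
  have i_iii: "(\<exists>x. is_solution st A b lam x) \<longleftrightarrow> converges"
    using converges_if_solution x0_solution by blast
  have i_ii: "(\<exists>x. is_solution st A b lam x) \<longleftrightarrow> (\<exists>x. is_least_solution st A b lam x)"
    using i_iii x0_least_solution unfolding is_least_solution_def by blast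
  have iii_iv: "converges \<longleftrightarrow> (\<forall>j\<in>J. star_converges st (mat_div (submatrix A (N j) (N j)) lam))"
    unfolding J_def by (rule converges_iff_class_stars[OF sys assms(3)])
  have iv_v: "(\<forall>j\<in>J. star_converges st (mat_div (submatrix A (N j) (N j)) lam)) \<longleftrightarrow>
      (case st of MaxTimes \<Rightarrow> max_perron_root st A N J \<le> lam | Nonneg \<Rightarrow> max_perron_root st A N J < lam)"
    by (rule class_stars_iff_max_perron_root[OF assms(1,2,3) _ lam]) (auto simp: J_def accessing_classes_def)
  have classes: "(i \<in> J \<longrightarrow> (\<exists>p\<in>N i. x0 $ p \<noteq> 0)) \<and> (i \<notin> J \<longrightarrow> (\<forall>p\<in>N i. x0 $ p = 0))"
    if conv: converges and i: "i < s" for i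
  proof -
    have "p < n" if "p \<in> N i" for p
      using frobenius_class_subset[OF assms(1,3) i] that by auto
    then have "x0 $ p \<noteq> 0 \<longleftrightarrow> (\<exists>t\<in>supp b. accesses A p t)" if "p \<in> N i" for p
      using x0_nonzero_iff[OF conv] that by blast
    moreover have "i \<in> J \<longleftrightarrow> (\<exists>p\<in>N i. \<exists>t\<in>supp b. accesses A p t)"
      using i by (simp add: J_def accessing_classes_def set_accesses_def)
    ultimately show ?thesis by blast
  qed
  show ?thesis
    unfolding Let_def J_def[symmetric]
  proof (intro conjI[OF i_ii] conjI impI)
    show "(\<exists>x. is_solution st A b lam x) \<longleftrightarrow> converges" by (rule i_iii)
    show "(\<exists>x. is_solution st A b lam x) \<longleftrightarrow> (\<forall>j\<in>J. star_converges st (mat_div (submatrix A (N j) (N j)) lam))"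
      by (simp only: i_iii iii_iv)
    show "(\<exists>x. is_solution st A b lam x) \<longleftrightarrow>
      (case st of MaxTimes \<Rightarrow> max_perron_root st A N J \<le> lam | Nonneg \<Rightarrow> max_perron_root st A N J < lam)"
      by (simp only: i_iii iii_iv iv_v)
  next
    assume "\<exists>x. is_solution st A b lam x"
    then have conv: converges by (simp only: i_iii)
    show "is_least_solution st A b lam x0" by (rule x0_least_solution[OF conv])
    show "\<forall>i<s. (i \<in> J \<longrightarrow> (\<exists>p\<in>N i. x0 $ p \<noteq> 0)) \<and> (i \<notin> J \<longrightarrow> (\<forall>p\<in>N i. x0 $ p = 0))"
      using classes[OF conv] by blast
    show "(\<exists>!x. is_solution st A b lam x) \<longleftrightarrow> \<not> s_eigenvalue st A lam"
      by (rule unique_solution_iff[OF conv])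
    show "\<forall>x. is_solution st A b lam x \<longrightarrow> (\<exists>v\<in>carrier_vec n. 0\<^sub>v n \<le> v \<and>
        s_mult_mat_vec st A v = lam \<cdot>\<^sub>v v \<and> x = s_add_vec st x0 v)"
      using solution_eq_x0_add by blast
  qed
qed

end
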